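(* Let $0<\alpha<\pi/2$. Let $F\in PW_\alpha$. Then there exists a function $f\in L^2(\mathbb T)$ with $\operatorname{supp} f\subseteq D_\alpha$ such that $$F(m,n)=\frac{1}{2\pi}\int_{\mathbb T} f(t)\, e_t(m,n)\, dt\qquad\text{for every }(m,n)\in\mathbb Z^2, \tag{1}$$ and moreover $$\|F\|_{PW_\alpha}=(2\pi)^{-1/2}\|f\|_{L^2(\mathbb T)}. \tag{2}$$ Conversely, let $f\in L^2(\mathbb T)$ be such that $\operatorname{supp} f\subseteq D_\alpha$. Then the function $F$ defined by (1) is in $PW_\alpha$ and (2) holds.
   Context: The torus $\mathbb T=\mathbb R/2\pi\mathbb Z$ is identified with $[-\pi,\pi)$, and $\|f\|_{L^2(\mathbb T)}^2=\int_{-\pi}^{\pi}|f(t)|^2\,dt$. For $f\in L^2(\mathbb T)$, $\operatorname{supp} f\subseteq D_\alpha$ means that $f=0$ almost everywhere outside $D_\alpha$. A function $F:\mathbb Z^2\to\mathbb C$ is (discrete) entire if $F(m+1,n+1)-F(m,n)=-i\big(F(m,n+1)-F(m+1,n)\big)$ for every $(m,n)\in\mathbb Z^2$. For $t\in\mathbb T$, $t\neq\pm\pi/2$, the discrete exponential is $e_t:\mathbb Z^2\to\mathbb C$, $e_t(m,n)=e^{itm}\Big(\frac{1+ie^{it}}{i+e^{it}}\Big)^n$. For $0<\alpha<\pi/2$, $D_\alpha=\{t\in\mathbb T: |t|\leqslant\alpha\}\cup\{t\in\mathbb T:\pi-\alpha\leqslant|t|\leqslant\pi\}$. The space $PW_\alpha$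 is the set of all entire $F:\mathbb Z^2\to\mathbb C$ such that (i) there exists $c>0$ with $|F(m,n)|\leqslant c\,|e_{-\alpha}(0,1)|^{|n|}$ for every $(m,n)\in\mathbb Z^2$, and (ii) $\sum_{m\in\mathbb Z}|F(m,0)|^2<+\infty$; it is endowed with $\|F\|_{PW_\alpha}^2=\sum_{m\in\mathbb Z}|F(m,0)|^2$. *)

theory Defs
  imports "HOL-Analysis.Analysis"
begin

text \<open>
  The torus is its fundamental domain \<open>[-pi, pi)\<close> with Lebesgue measure (total mass \<open>2 pi\<close>,
  not normalised).  A function on the torus is a function on the reals of which only the values
  on \<open>[-pi, pi)\<close> matter; elements of \<open>L\<^sup>2\<close> are represented by functions, not by classes modulo
  equality almost everywhere.
\<close>

definition torus :: "real measure" where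
  "torus = lebesgue_on {-pi..<pi}"

definition L2_torus :: "(real \<Rightarrow> complex) set" where
  "L2_torus = {f. f \<in> borel_measurable torus \<and> integrable torus (\<lambda>t. (cmod (f t))\<^sup>2)}"

definition L2_torus_norm :: "(real \<Rightarrow> complex) \<Rightarrow> real" where
  "L2_torus_norm f = sqrt (LINT t|torus. (cmod (f t))\<^sup>2)"

definition D :: "real \<Rightarrow> real set" where
  "D \<alpha> = {t \<in> {-pi..<pi}. \<bar>t\<bar> \<le> \<alpha> \<or> (pi - \<alpha> \<le> \<bar>t\<bar> \<and> \<bar>t\<bar> \<le> pi)}"

definition supp_subset :: "(real \<Rightarrow> complex) \<Rightarrow> real set \<Rightarrow> bool" where
  "supp_subset f A \<longleftrightarrow> (AE t in torus. t \<notin> A \<longrightarrow> f t = 0)"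

definition discrete_entire :: "(int \<Rightarrow> int \<Rightarrow> complex) \<Rightarrow> bool" where
  "discrete_entire F \<longleftrightarrow>
     (\<forall>m n. F (m + 1) (n + 1) - F m n = - \<i> * (F m (n + 1) - F (m + 1) n))"

text \<open>
  The discrete exponential \<open>e\<^sub>t(m, n)\<close> is meaningful only for \<open>t \<noteq> \<plusminus> pi/2\<close>, where the base of the
  \<open>n\<close>-th power has a zero or a pole; these two points lie outside \<open>D \<alpha>\<close> for \<open>0 < \<alpha> < pi/2\<close>.
\<close>

definition discrete_exp :: "real \<Rightarrow> int \<Rightarrow> int \<Rightarrow> complex" where
  "discrete_exp t m n =
     exp (\<i> * of_real t * of_int m) *
     ((1 + \<i> * exp (\<i> * of_real t)) / (\<i> + exp (\<i> * of_real t))) powi n"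

definition PW :: "real \<Rightarrow> (int \<Rightarrow> int \<Rightarrow> complex) set" where
  "PW \<alpha> = {F. discrete_entire F \<and>
     (\<exists>c>0. \<forall>m n. cmod (F m n) \<le> c * cmod (discrete_exp (- \<alpha>) 0 1) powi \<bar>n\<bar>) \<and>
     (\<lambda>m. (cmod (F m 0))\<^sup>2) summable_on UNIV}"

definition PW_norm :: "(int \<Rightarrow> int \<Rightarrow> complex) \<Rightarrow> real" where
  "PW_norm F = sqrt (\<Sum>\<^sub>\<infinity>m. (cmod (F m 0))\<^sup>2)"

definition PW_transform :: "(real \<Rightarrow> complex) \<Rightarrow> int \<Rightarrow> int \<Rightarrow> complex" where
  "PW_transform f m n = 1 / (2 * of_real pi) * (LINT t|torus. f t * discrete_exp t m n)"

end

theory Submission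
  imports Defs
begin

text \<open>
  The numbers \<open>F m 0\<close> of a function \<open>F = PW_transform f\<close> are the Fourier coefficients of \<open>f\<close>, so
  the norm identity is Parseval's identity. The remaining content concerns the rows \<open>n \<noteq> 0\<close>. With
  \<open>\<lambda>(t) = discrete_exp t 0 1 = (1 + \<i>w) / (\<i> + w)\<close> and \<open>w = cis t\<close>, one has
  \<open>\<bar>\<lambda>(t)\<bar>\<^sup>2 = (1 - sin t) / (1 + sin t)\<close>, and \<open>t \<in> D \<alpha>\<close> says that both \<open>\<bar>\<lambda>(t)\<bar>\<close> and \<open>1 / \<bar>\<lambda>(t)\<bar>\<close> are at
  most \<open>K = \<bar>\<lambda>(-\<alpha>)\<bar>\<close>. If \<open>f\<close> is supported there, the growth bound on \<open>F\<close> is immediate, and \<open>F\<close> is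
  entire since every \<open>discrete_exp t\<close> with \<open>t \<in> D \<alpha>\<close> is (\<open>PW_transform_in_PW\<close>).
  
  For the other direction take \<open>F \<in> PW \<alpha>\<close> and let \<open>f\<close> be the function whose Fourier coefficients
  form the row \<open>n = 0\<close> (\<open>Riesz_Fischer\<close>). The point is that \<open>f\<close> vanishes outside \<open>D \<alpha>\<close>
  (\<open>supp_subset_D\<close>). On the arc \<open>(-pi + \<alpha>, -\<alpha>)\<close> the number \<open>x = 1 / \<lambda>(t)\<close> satisfies \<open>K \<bar>x\<bar> < 1\<close>, so
  \<open>P m = (\<Sum>n. F m n x\<^sup>n)\<close> converges, and on compact subarcs it and its derivative in \<open>x\<close> are bounded
  independently of \<open>m\<close>. The equation of entire functions turns into a recurrence in \<open>m\<close> alone,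
  \<open>(1 - \<i>x) P (m + 1) + (\<i> - x) P m = F (m + 1) 0 + \<i> F m 0\<close>, in which the two coefficients on the
  left have quotient \<open>-w\<close>. Hence the Fourier partial sum of \<open>(1 + \<i> cis (-t)) f\<close> telescopes: up to
  boundary terms it is \<open>(1 - \<i>x) (cis (-N t) P N - cis (N t) P (-N))\<close>, a fast oscillation times an
  amplitude with uniformly bounded derivative. Integration by parts shows that its integral over
  every compact subinterval of the arc tends to \<open>0\<close>. These integrals also tend to those of
  \<open>(1 + \<i> cis (-t)) f\<close>, which therefore vanish, and \<open>f = 0\<close> almost everywhere on the arc. The opposite
  arc reduces to this one by the symmetry \<open>F (-m) (-n)\<close>, \<open>t \<mapsto> -t\<close>.
  
  It remains to see that \<open>F\<close> and \<open>PW_transform f\<close> agree on all rows, although the equation determines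
  the next row only up to a multiple of \<open>(-\<i>)\<^sup>m\<close>. A nonzero multiple would force linear growth in \<open>m\<close>
  on the row after it, and the rows of functions in \<open>PW \<alpha>\<close> are bounded
  (\<open>entire_eq_0_if_row_0_eq_0\<close>).
  
  The Fourier theory is built from two ingredients: the trigonometric polynomials are uniformly dense
  in the continuous functions on the circle, and an \<open>L\<^sup>1\<close>-Cauchy sequence has a subsequence that
  converges almost everywhere.
\<close>

section \<open>Integration on the torus\<close>

lemma space_torus [simp]: "space torus = {-pi..<pi}"
  by (simp add: torus_def space_restrict_space)

lemma finite_measure_torus: "finite_measure torus"
  unfolding torus_def by (rule finite_measureI) (simp add: emeasure_restrict_space)

interpretation torus: finite_measure torus by (rule finite_measure_torus)

lemma measure_torus: "measure torus (space torus) = 2 * pi"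
  by (simp add: torus_def measure_restrict_space space_restrict_space)

lemma AE_torus_neq: "AE t in torus. t \<noteq> a"
proof -
  have "AE t in lebesgue. t \<notin> {a}"
    by (intro AE_not_in) (metis negligible_sing negligible_iff_null_sets)
  then show ?thesis unfolding torus_def by (auto simp: AE_restrict_space_iff)
qed

lemma measurable_torus_continuous:
  fixes g :: "real \<Rightarrow> 'a::euclidean_space"
  assumes "continuous_on UNIV g"
  shows "g \<in> borel_measurable torus"
proof -
  have "g \<in> borel_measurable lebesgue"
    using borel_measurable_continuous_onI[OF assms] borel_measurable_if_lebesgue_on by (simp add: measurable_completion)
  then show ?thesis unfolding torus_def by (rule measurable_restrict_space1)
qed

lemma integrable_torus_bounded_mult:
  fixes f g :: "real \<Rightarrow> complex"
  assumes f: "integrable torus f" and g: "g \<in> borel_measurable torus"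
    and B: "AE t in torus. cmod (g t) \<le> B \<or> f t = 0"
  shows "integrable torus (\<lambda>t. f t * g t)"
proof (rule Bochner_Integration.integrable_bound)
  show "integrable torus (\<lambda>t. B *\<^sub>R f t)" using f by simp
  show "(\<lambda>t. f t * g t) \<in> borel_measurable torus" using f g by measurable
  show "AE t in torus. norm (f t * g t) \<le> norm (B *\<^sub>R f t)"
    using B
  proof eventually_elim
    case (elim t)
    then show ?case
    proof
      assume "cmod (g t) \<le> B"
      then have "cmod (f t) * cmod (g t) \<le> cmod (f t) * \<bar>B\<bar>" by (intro mult_left_mono) auto
      then show ?thesis by (simp add: norm_mult mult.commute)
    qed simp
  qed
qed

lemma torus_set_integral:
  fixes f :: "real \<Rightarrow> complex"
  assumes "continuous_on {p..q} f" "-pi \<le> p" "q < pi"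
  shows "(LINT t:{p..q}|torus. f t) = integral {p..q} f"
proof -
  have "(LINT t:{p..q}|torus. f t) = (LINT t|lebesgue_on {-pi..<pi}. (if t \<in> {p..q} then f t else 0))"
    unfolding set_lebesgue_integral_def torus_def by (simp add: indicator_scaleR_eq_if)
  also have "\<dots> = (LINT t|lebesgue_on {p..q}. f t)"
    using assms by (intro Lebesgue_Measure.integral_restrict) auto
  also have "\<dots> = integral {p..q} f"
    by (intro lebesgue_integral_eq_integral continuous_imp_integrable_real assms) auto
  finally show ?thesis .
qed

lemma torus_integral_continuous:
  fixes f :: "real \<Rightarrow> complex"
  assumes "continuous_on UNIV f"
  shows "integrable torus f" "(LINT t|torus. f t) = integral {-pi..pi} f"
proof -
  have i: "integrable (lebesgue_on {-pi..pi}) f"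
    using assms by (intro continuous_imp_integrable_real) (auto intro: continuous_on_subset)
  then show int: "integrable torus f"
  proof -
    have "set_integrable lebesgue {-pi..pi} f"
      using i by (simp add: set_integrable_def integrable_restrict_space)
    then have "set_integrable lebesgue {-pi..<pi} f"
      by (rule set_integrable_subset) auto
    then show ?thesis
      by (simp add: torus_def set_integrable_def integrable_restrict_space)
  qed
  have "(LINT t|torus. f t) = integral {-pi..<pi} f"
    using int unfolding torus_def by (intro lebesgue_integral_eq_integral) auto
  also have "\<dots> = integral {-pi..pi} f"
    by (rule integral_spike_set) (auto intro: negligible_subset[of "{pi}"])
  finally show "(LINT t|torus. f t) = integral {-pi..pi} f" .
qed

section \<open>Trigonometric sums and Bessel's inequality\<close>

definition torus_char :: "int \<Rightarrow> real \<Rightarrow> complex" where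
  "torus_char m t = cis (of_int m * t)"

lemma torus_char_add: "torus_char (m + n) t = torus_char m t * torus_char n t"
  by (simp add: torus_char_def cis_mult algebra_simps)

lemma torus_char_0 [simp]: "torus_char 0 t = 1"
  by (simp add: torus_char_def)

lemma norm_torus_char [simp]: "cmod (torus_char m t) = 1"
  by (simp add: torus_char_def)

lemma cnj_torus_char: "cnj (torus_char m t) = torus_char (- m) t"
  by (simp add: torus_char_def cis_cnj)

lemma continuous_torus_char: "continuous_on A (torus_char m)"
  unfolding torus_char_def [abs_def] by (intro continuous_intros)

lemma measurable_torus_char [measurable]: "torus_char m \<in> borel_measurable torus"
  by (intro measurable_torus_continuous continuous_torus_char)

lemma discrete_exp_row_0: "discrete_exp t m 0 = torus_char m t"
  by (simp add: discrete_exp_def torus_char_def cis_conv_exp mult_ac)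

lemma PW_transform_row_0: "PW_transform f m 0 = 1 / (2 * of_real pi) * (LINT t|torus. f t * torus_char m t)"
  by (simp add: PW_transform_def discrete_exp_row_0)

lemma integral_torus_char: "(LINT t|torus. torus_char m t) = (if m = 0 then 2 * of_real pi else 0)"
proof (cases "m = 0")
  case True
  then have "(LINT t|torus. torus_char m t) = (LINT t|torus. 1)" by (simp add: torus_char_def)
  also have "\<dots> = of_real (measure torus (space torus))"
    by (simp add: scaleR_conv_of_real)
  finally show ?thesis using True by (simp add: measure_torus del: space_torus)
next
  case False
  define g where "g = (\<lambda>t. torus_char m t / (\<i> * of_int m))"
  have "(g has_vector_derivative torus_char m t) (at t within {-pi..pi})" for t
    unfolding g_def torus_char_def using False
    by (auto intro!: derivative_eq_intros has_vector_derivative_real_field simp: cis_conv_exp field_simps)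
  then have "(torus_char m has_integral (g pi - g (-pi))) {-pi..pi}"
    by (intro fundamental_theorem_of_calculus) auto
  moreover have "g pi = g (-pi)"
  proof -
    have "torus_char m pi = torus_char m (- pi)"
    proof -
      have "torus_char m pi = torus_char m (- pi) * cis (2 * pi * of_int m)"
        by (simp add: torus_char_def cis_mult algebra_simps)
      also have "cis (2 * pi * of_int m) = 1" by (rule cis_multiple_2pi) simp
      finally show ?thesis by simp
    qed
    then show ?thesis by (simp add: g_def)
  qed
  ultimately have "integral {-pi..pi} (torus_char m) = 0"
    by (simp add: integral_unique)
  then show ?thesis using False by (simp add: torus_integral_continuous(2) continuous_torus_char)
qed

lemma L2_torus_square_integrable: "f \<in> L2_torus \<Longrightarrow> integrable torus (\<lambda>t. (cmod (f t))\<^sup>2)"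
  by (simp add: L2_torus_def)

lemma L2_torus_integrable:
  assumes "f \<in> L2_torus" shows "integrable torus f"
proof -
  have [measurable]: "f \<in> borel_measurable torus" using assms by (simp add: L2_torus_def)
  have "integrable torus (\<lambda>t. cmod (f t))"
  proof (rule torus.square_integrable_imp_integrable)
    show "integrable torus (\<lambda>t. (cmod (f t))\<^sup>2)" using assms by (simp add: L2_torus_def)
  qed measurable
  then show ?thesis by (simp add: integrable_norm_iff)
qed

lemma L2_torus_diff:
  assumes "f \<in> L2_torus" "g \<in> L2_torus"
  shows "(\<lambda>t. f t - g t) \<in> L2_torus"
proof -
  have [measurable]: "f \<in> borel_measurable torus" "g \<in> borel_measurable torus"
    using assms by (simp_all add: L2_torus_def)
  have "integrable torus (\<lambda>t. (cmod (f t - g t))\<^sup>2)"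
  proof (rule Bochner_Integration.integrable_bound)
    show "integrable torus (\<lambda>t. 2 * (cmod (f t))\<^sup>2 + 2 * (cmod (g t))\<^sup>2)"
      using assms by (auto simp: L2_torus_def)
    have "(cmod (f t - g t))\<^sup>2 \<le> 2 * (cmod (f t))\<^sup>2 + 2 * (cmod (g t))\<^sup>2" for t
    proof -
      have "(cmod (f t - g t))\<^sup>2 \<le> (cmod (f t) + cmod (g t))\<^sup>2"
        by (intro power_mono norm_triangle_ineq4) simp
      also have "\<dots> \<le> 2 * (cmod (f t))\<^sup>2 + 2 * (cmod (g t))\<^sup>2"
        using zero_le_power2[of "cmod (f t) - cmod (g t)"] by (simp add: power2_eq_square algebra_simps)
      finally show ?thesis .
    qed
    then show "AE t in torus. norm ((cmod (f t - g t))\<^sup>2) \<le> norm (2 * (cmod (f t))\<^sup>2 + 2 * (cmod (g t))\<^sup>2)"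
      by (intro AE_I2) (auto intro: order_trans[OF _ abs_ge_self])
  qed measurable
  then show ?thesis by (simp add: L2_torus_def)
qed

lemma L2_torus_continuous:
  assumes "continuous_on UNIV f" shows "f \<in> L2_torus"
proof -
  have "continuous_on UNIV (\<lambda>t. complex_of_real ((cmod (f t))\<^sup>2))"
    using assms by (intro continuous_intros)
  then have "integrable torus (\<lambda>t. complex_of_real ((cmod (f t))\<^sup>2))"
    by (rule torus_integral_continuous)
  then have "integrable torus (\<lambda>t. (cmod (f t))\<^sup>2)"
    by (simp only: complex_of_real_integrable_eq)
  then show ?thesis using assms by (simp add: L2_torus_def measurable_torus_continuous)
qed

text \<open>
  The signs match \<open>PW_transform f m 0\<close>, which pairs \<open>f\<close> with the character of frequency \<open>m\<close>; the
  coefficient with index \<open>m\<close> therefore belongs to the frequency \<open>-m\<close>.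
\<close>

definition trig_sum :: "(int \<Rightarrow> complex) \<Rightarrow> int set \<Rightarrow> real \<Rightarrow> complex" where
  "trig_sum c A t = (\<Sum>m\<in>A. c m * torus_char (- m) t)"

lemma continuous_trig_sum: "continuous_on B (trig_sum c A)"
  unfolding trig_sum_def [abs_def] by (intro continuous_intros continuous_torus_char)

lemma trig_sum_L2: "trig_sum c A \<in> L2_torus"
  by (intro L2_torus_continuous continuous_trig_sum)

lemma integrable_mult_torus_char:
  assumes "integrable torus f" shows "integrable torus (\<lambda>t. f t * torus_char m t)"
  by (rule integrable_torus_bounded_mult[where B=1]) (use assms in auto)

text \<open>
  Expanding the square and using orthogonality of the characters. The coefficients \<open>a\<close> are arbitrary:
  taking for \<open>a\<close> the Fourier coefficients of \<open>f\<close> gives Bessel's identity, and \<open>f = 0\<close> gives the norm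
  of a trigonometric sum.
\<close>

lemma norm_diff_trig_sum_square:
  assumes f: "f \<in> L2_torus" and A: "finite A"
  shows "(LINT t|torus. (cmod (f t - trig_sum a A t))\<^sup>2) =
     (LINT t|torus. (cmod (f t))\<^sup>2) - 2 * pi * (\<Sum>m\<in>A. 2 * Re (PW_transform f m 0 * cnj (a m)))
       + 2 * pi * (\<Sum>m\<in>A. (cmod (a m))\<^sup>2)"
proof -
  have fi: "integrable torus f" by (rule L2_torus_integrable[OF f])
  note [simp] = integrable_mult_torus_char[OF fi] torus_integral_continuous(1)[OF continuous_torus_char]
  define c where "c = (\<lambda>m. PW_transform f m 0)"
  have cm: "(LINT t|torus. f t * torus_char m t) = 2 * of_real pi * c m" for m
    by (simp add: c_def PW_transform_row_0)
  have pw: "(cmod (f t - trig_sum a A t))\<^sup>2 = (cmod (f t))\<^sup>2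
     - 2 * Re (\<Sum>m\<in>A. cnj (a m) * (f t * torus_char m t))
     + Re (\<Sum>m\<in>A. \<Sum>n\<in>A. a m * cnj (a n) * torus_char (n - m) t)" for t
  proof -
    let ?p = "trig_sum a A t"
    have "(cmod (f t - ?p))\<^sup>2 = (cmod (f t))\<^sup>2 - 2 * Re (f t * cnj ?p) + Re (?p * cnj ?p)"
      by (simp add: cmod_power2) (simp add: power2_eq_square algebra_simps)
    also have "f t * cnj ?p = (\<Sum>m\<in>A. cnj (a m) * (f t * torus_char m t))"
      by (simp add: trig_sum_def cnj_torus_char sum_distrib_left mult_ac)
    also have "?p * cnj ?p = (\<Sum>m\<in>A. \<Sum>n\<in>A. a m * cnj (a n) * torus_char (n - m) t)"
      by (simp add: trig_sum_def cnj_torus_char sum_product diff_conv_add_uminus torus_char_add mult_ac del: add_uminus_conv_diff)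
    finally show ?thesis .
  qed
  have "(LINT t|torus. (cmod (f t - trig_sum a A t))\<^sup>2) = (LINT t|torus. (cmod (f t))\<^sup>2)
     - 2 * Re (LINT t|torus. (\<Sum>m\<in>A. cnj (a m) * (f t * torus_char m t)))
     + Re (LINT t|torus. (\<Sum>m\<in>A. \<Sum>n\<in>A. a m * cnj (a n) * torus_char (n - m) t))"
    unfolding pw using L2_torus_square_integrable[OF f]
    by (simp del: Re_sum)
  also have "(LINT t|torus. (\<Sum>m\<in>A. cnj (a m) * (f t * torus_char m t))) = (\<Sum>m\<in>A. 2 * of_real pi * (c m * cnj (a m)))"
    by (subst Bochner_Integration.integral_sum, simp, simp add: cm, simp add: mult_ac)
  also have "(LINT t|torus. (\<Sum>m\<in>A. \<Sum>n\<in>A. a m * cnj (a n) * torus_char (n - m) t)) 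
     = (\<Sum>m\<in>A. \<Sum>n\<in>A. a m * cnj (a n) * (if n = m then 2 * of_real pi else 0))"
    by (subst Bochner_Integration.integral_sum | simp add: integral_torus_char)+
  also have "\<dots> = (\<Sum>m\<in>A. 2 * of_real pi * of_real ((cmod (a m))\<^sup>2))"
    using A by (intro sum.cong refl) (simp add: if_distrib sum.delta complex_norm_square mult_ac del: of_real_power cong: if_cong)
  finally show ?thesis
    by (simp add: c_def sum_distrib_left mult_ac)
qed

lemma Bessel_identity:
  assumes "f \<in> L2_torus" "finite A"
  shows "(LINT t|torus. (cmod (f t - trig_sum (\<lambda>m. PW_transform f m 0) A t))\<^sup>2) =
     (LINT t|torus. (cmod (f t))\<^sup>2) - 2 * pi * (\<Sum>m\<in>A. (cmod (PW_transform f m 0))\<^sup>2)"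
proof -
  have "Re (z * cnj z) = (cmod z)\<^sup>2" for z
    unfolding cmod_power2 by (simp add: power2_eq_square)
  then show ?thesis
    unfolding norm_diff_trig_sum_square[OF assms] by (simp only: flip: sum_distrib_left)
qed

lemma Bessel_inequality:
  assumes "f \<in> L2_torus" "finite A"
  shows "2 * pi * (\<Sum>m\<in>A. (cmod (PW_transform f m 0))\<^sup>2) \<le> (LINT t|torus. (cmod (f t))\<^sup>2)"
proof -
  have "0 \<le> (LINT t|torus. (cmod (f t - trig_sum (\<lambda>m. PW_transform f m 0) A t))\<^sup>2)"
    by (intro Bochner_Integration.integral_nonneg) simp
  then show ?thesis using Bessel_identity[OF assms] by simp
qed

lemma norm_trig_sum_square:
  assumes "finite A"
  shows "(LINT t|torus. (cmod (trig_sum a A t))\<^sup>2) = 2 * pi * (\<Sum>m\<in>A. (cmod (a m))\<^sup>2)"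
proof -
  have "(\<lambda>_. 0) \<in> L2_torus" by (simp add: L2_torus_def)
  from norm_diff_trig_sum_square[OF this assms, of a] show ?thesis
    by (simp add: PW_transform_def)
qed

text \<open>
  A Cauchy--Schwarz inequality with free parameter: it follows from \<open>2 s x \<le> s\<^sup>2 x\<^sup>2 + 1\<close> by integrating.
  Choosing \<open>s\<close> large first and the \<open>L\<^sup>2\<close> norm small afterwards makes the \<open>L\<^sup>1\<close> norm small.
\<close>

lemma L1_torus_bound:
  assumes f: "f \<in> L2_torus" and s: "s > 0"
  shows "(LINT t|torus. cmod (f t)) \<le> s * (LINT t|torus. (cmod (f t))\<^sup>2) + 2 * pi / s"
proof -
  have "(LINT t|torus. cmod (f t)) \<le> (LINT t|torus. s * (cmod (f t))\<^sup>2 + 1 / s)"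
  proof (rule integral_mono)
    fix t
    have "0 \<le> (s * cmod (f t) - 1)\<^sup>2 + s * cmod (f t)" using s by simp
    also have "\<dots> = s * (s * (cmod (f t))\<^sup>2 + 1 / s - cmod (f t))"
      using s by (simp add: power2_eq_square algebra_simps)
    finally show "cmod (f t) \<le> s * (cmod (f t))\<^sup>2 + 1 / s"
      using s mult_neg_pos[of "s * (cmod (f t))\<^sup>2 + 1 / s - cmod (f t)" s] by (force simp: mult.commute)
  qed (use L2_torus_integrable[OF f] L2_torus_square_integrable[OF f] in auto)
  also have "\<dots> = s * (LINT t|torus. (cmod (f t))\<^sup>2) + 2 * pi / s"
    using L2_torus_square_integrable[OF f] measure_torus by (simp del: space_torus)
  finally show ?thesis .
qed

lemma L1_small_if_L2_small:
  assumes "e > 0"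
  obtains d where "d > 0" "\<And>f. f \<in> L2_torus \<Longrightarrow> (LINT t|torus. (cmod (f t))\<^sup>2) < d \<Longrightarrow> (LINT t|torus. cmod (f t)) < e"
proof -
  define s where "s = 4 * pi / e"
  have s: "s > 0" using assms by (simp add: s_def)
  show thesis
  proof (rule that[of "e / (2 * s)"])
    show "e / (2 * s) > 0" using s assms by simp
    fix f assume f: "f \<in> L2_torus" "(LINT t|torus. (cmod (f t))\<^sup>2) < e / (2 * s)"
    have "(LINT t|torus. cmod (f t)) \<le> s * (LINT t|torus. (cmod (f t))\<^sup>2) + 2 * pi / s"
      by (rule L1_torus_bound[OF f(1) s])
    also have "\<dots> < s * (e / (2 * s)) + 2 * pi / s"
      using mult_strict_left_mono[OF f(2) s] by linarith
    also have "\<dots> = e" using s assms by (simp add: s_def)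
    finally show "(LINT t|torus. cmod (f t)) < e" .
  qed
qed

section \<open>Functions with vanishing integrals over intervals\<close>

lemma sigma_finite_lebesgue: "sigma_finite_measure (lebesgue :: real measure)"
proof
  obtain A :: "real set set" where A: "countable A \<and> A \<subseteq> sets lborel \<and> \<Union>A = space lborel \<and>
      (\<forall>a\<in>A. emeasure lborel a \<noteq> \<infinity>)"
    using lborel.sigma_finite_countable by (rule exE)
  have "emeasure lebesgue a = emeasure lborel a" if "a \<in> A" for a
  proof -
    have "a \<in> sets lborel" using that A by blast
    then show ?thesis by simp
  qed
  moreover have "A \<subseteq> sets lebesgue" using A by auto
  ultimately show "\<exists>A::real set set. countable A \<and> A \<subseteq> sets lebesgue \<and> \<Union>A = space lebesgue \<and>
      (\<forall>a\<in>A. emeasure lebesgue a \<noteq> \<infinity>)"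
    using A by (intro exI[of _ A] conjI ballI) auto
qed

text \<open>
  The Borel sets over which \<open>f\<close> has integral \<open>0\<close> form a Dynkin system that contains the open
  intervals, hence all Borel sets. Lebesgue sets differ from Borel sets by null sets.
\<close>

lemma interval_integrals_zero_imp_AE_zero:
  fixes f :: "real \<Rightarrow> complex"
  assumes f: "integrable lebesgue f"
    and zero: "\<And>p q. p < q \<Longrightarrow> (LINT t:{p<..<q}|lebesgue. f t) = 0"
  shows "AE t in lebesgue. f t = 0"
proof (rule sigma_finite_measure.density_zero[OF sigma_finite_lebesgue f])
  have si: "set_integrable lebesgue A f" if "A \<in> sets lebesgue" for A
    unfolding set_integrable_def using that f by (rule integrable_mult_indicator)
  define G where "G = range (\<lambda>(a, b). box a b :: real set)"
  have borel_G: "sets (borel :: real measure) = sigma_sets UNIV G"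
    unfolding G_def by (subst borel_eq_box) (rule sets_measure_of, simp)
  have total: "(LINT t|lebesgue. f t) = 0"
  proof -
    have "(\<lambda>n::nat. LINT t|lebesgue. indicator {-real n<..<real n} t *\<^sub>R f t) \<longlonglongrightarrow> (LINT t|lebesgue. f t)"
    proof (rule integral_dominated_convergence[where w="\<lambda>t. norm (f t)"])
      show "AE t in lebesgue. (\<lambda>n. indicator {-real n<..<real n} t *\<^sub>R f t) \<longlonglongrightarrow> f t"
      proof (intro AE_I2 tendsto_eventually)
        fix t :: real
        obtain N where N: "\<bar>t\<bar> < real N" using reals_Archimedean2 by blast
        show "\<forall>\<^sub>F n in sequentially. indicator {-real n<..<real n} t *\<^sub>R f t = f t"
          using eventually_ge_at_top[of N] by eventually_elim (use N in \<open>auto simp: indicator_def\<close>)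
      qed
    qed (use f in \<open>auto split: split_indicator intro!: borel_measurable_scaleR borel_measurable_indicator\<close>)
    moreover have "(LINT t|lebesgue. indicator {-real n<..<real n} t *\<^sub>R f t) = 0" for n
      using zero[of "-real n" "real n"] by (cases n) (auto simp: set_lebesgue_integral_def)
    ultimately have "(\<lambda>n::nat. 0) \<longlonglongrightarrow> (LINT t|lebesgue. f t)" by simp
    then show ?thesis by (simp add: LIMSEQ_const_iff)
  qed
  have borel0: "(LINT t:A|lebesgue. f t) = 0" if "A \<in> sets borel" for A
  proof -
    have "Int_stable G"
    proof (rule Int_stableI)
      fix X Y assume "X \<in> G" "Y \<in> G"
      then obtain a b c d where "X = {a<..<b}" "Y = {c<..<d}" by (auto simp: G_def)
      then have "X \<inter> Y = (\<lambda>(a, b). box a b) (max a c, min b d)" by auto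
      then show "X \<inter> Y \<in> G" unfolding G_def by (rule range_eqI)
    qed
    moreover have "G \<subseteq> Pow UNIV" by simp
    moreover have "A \<in> sigma_sets UNIV G" using that borel_G by simp
    ultimately show ?thesis
    proof (induction rule: sigma_sets_induct_disjoint)
      case (basic A)
      then obtain a b where "A = {a<..<b}" by (auto simp: G_def)
      then show ?case using zero[of a b] by (cases "a < b") (auto simp: set_lebesgue_integral_def)
    next
      case (compl A)
      then have A: "A \<in> sets lebesgue" using borel_G by auto
      have "(LINT t|lebesgue. f t) = (LINT t:A \<union> (UNIV - A)|lebesgue. f t)"
        by (simp add: set_lebesgue_integral_def)
      also have "\<dots> = (LINT t:A|lebesgue. f t) + (LINT t:UNIV - A|lebesgue. f t)"
        using A by (intro set_integral_Un si) auto
      finally show ?case using compl total by simp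
    next
      case (union A)
      have A: "A i \<in> sets lebesgue" for i
      proof -
        have "A i \<in> sets (borel :: real measure)" unfolding borel_G using union(2) by auto
        then show ?thesis by simp
      qed
      have "(LINT t:(\<Union>i. A i)|lebesgue. f t) = (\<Sum>i. (LINT t:(A i)|lebesgue. f t))"
        using union(1) A by (intro lebesgue_integral_countable_add si) (auto simp: disjoint_family_on_def)
      then show ?case using union by simp
    qed (auto simp: set_lebesgue_integral_def)
  qed
  fix A :: "real set" assume "A \<in> sets lebesgue"
  then obtain S N N' where A: "A = S \<union> N" "N \<subseteq> N'" "N' \<in> null_sets lborel" "S \<in> sets lborel"
    by (rule sets_completionE)
  have N': "AE t in lebesgue. t \<notin> N'" using A(3) by (intro AE_not_in null_sets_completionI)
  have "(LINT t:A|lebesgue. f t) = (LINT t:S|lebesgue. f t)"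
    unfolding set_lebesgue_integral_def
  proof (rule integral_cong_AE)
    show "AE t in lebesgue. indicat_real A t *\<^sub>R f t = indicat_real S t *\<^sub>R f t"
      using N' by eventually_elim (use A in \<open>auto simp: indicator_def\<close>)
    show "(\<lambda>t. indicat_real S t *\<^sub>R f t) \<in> borel_measurable lebesgue"
      using A(4) by (intro borel_measurable_scaleR borel_measurable_indicator borel_measurable_integrable[OF f]) simp
    show "(\<lambda>t. indicat_real A t *\<^sub>R f t) \<in> borel_measurable lebesgue"
      using \<open>A \<in> sets lebesgue\<close>
      by (intro borel_measurable_scaleR borel_measurable_indicator borel_measurable_integrable[OF f])
  qed
  then show "(LINT t:A|lebesgue. f t) = 0" using borel0 A(4) by simp
qed

text \<open>
  A localised version for the torus. Only compact subintervals of \<open>(u, v)\<close> are tested, because the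
  estimates that feed this lemma degenerate at the ends of the arc; the open intervals are recovered by
  dominated convergence.
\<close>

lemma torus_AE_zero_on_interval:
  fixes f :: "real \<Rightarrow> complex"
  assumes f: "integrable torus f" and uv: "-pi \<le> u" "v \<le> pi"
    and zero: "\<And>p q. u < p \<Longrightarrow> p < q \<Longrightarrow> q < v \<Longrightarrow> (LINT t:{p..q}|torus. f t) = 0"
  shows "AE t in torus. u < t \<and> t < v \<longrightarrow> f t = 0"
proof -
  define h where "h = (\<lambda>t. indicator {u<..<v} t *\<^sub>R f t)"
  have sub: "{u<..<v} \<subseteq> {-pi..<pi}" using uv by auto
  have hl: "indicator {-pi..<pi} t *\<^sub>R h t = h t" for t
    using sub by (auto simp: h_def indicator_def)
  have "integrable torus h"
    unfolding h_def using uv f by (intro integrable_mult_indicator) (auto simp: torus_def sets_restrict_space_iff)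
  then have h: "integrable lebesgue h"
    by (simp add: torus_def integrable_restrict_space hl)
  have "AE t in lebesgue. h t = 0"
  proof (rule interval_integrals_zero_imp_AE_zero[OF h])
    fix p q :: real
    define p' q' where "p' = max p u" and "q' = min q v"
    have eq: "(LINT t:{p<..<q}|lebesgue. h t) = (LINT t|lebesgue. indicator {p'<..<q'} t *\<^sub>R h t)"
      unfolding set_lebesgue_integral_def
      by (intro Bochner_Integration.integral_cong) (auto simp: h_def indicator_def p'_def q'_def)
    define I where "I = (\<lambda>n::nat. {p' + 1 / (real n + 1)..q' - 1 / (real n + 1)})"
    have "(\<lambda>n. LINT t|lebesgue. indicator (I n) t *\<^sub>R h t) \<longlonglongrightarrow> (LINT t|lebesgue. indicator {p'<..<q'} t *\<^sub>R h t)"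
    proof (rule integral_dominated_convergence[where w="\<lambda>t. norm (h t)"])
      show "AE t in lebesgue. (\<lambda>n. indicator (I n) t *\<^sub>R h t) \<longlonglongrightarrow> indicator {p'<..<q'} t *\<^sub>R h t"
      proof (intro AE_I2 tendsto_eventually)
        fix t :: real
        show "\<forall>\<^sub>F n in sequentially. indicator (I n) t *\<^sub>R h t = indicator {p'<..<q'} t *\<^sub>R h t"
        proof (cases "t \<in> {p'<..<q'}")
          case True
          have "\<forall>\<^sub>F n in sequentially. 1 / (real n + 1) < min (t - p') (q' - t)"
            using True LIMSEQ_inverse_real_of_nat
            by (intro order_tendstoD(2)[of _ 0]) (auto simp: inverse_eq_divide add.commute)
          then show ?thesis
            by eventually_elim (use True in \<open>auto simp: I_def indicator_def\<close>)
        next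
          case False
          have "t \<notin> I n" for n
          proof -
            have "1 / (real n + 1) > 0" by simp
            then show ?thesis using False unfolding I_def atLeastAtMost_iff greaterThanLessThan_iff by linarith
          qed
          then show ?thesis using False by simp
        qed
      qed
    qed (use h in \<open>auto simp: I_def split: split_indicator intro!: borel_measurable_scaleR borel_measurable_indicator\<close>)
    moreover have "(LINT t|lebesgue. indicator (I n) t *\<^sub>R h t) = 0" for n
    proof -
      have e: "1 / (real n + 1) > 0" by simp
      define a b where "a = p' + 1 / (real n + 1)" and "b = q' - 1 / (real n + 1)"
      have ab: "u < a" "b < v" using e unfolding a_def b_def p'_def q'_def by linarith+
      have "(LINT t|lebesgue. indicator (I n) t *\<^sub>R h t) = (LINT t|lebesgue. indicator {-pi..<pi} t *\<^sub>R (indicator {a..b} t *\<^sub>R f t))"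
        using ab uv by (intro Bochner_Integration.integral_cong) (auto simp: I_def a_def b_def h_def indicator_def)
      also have "\<dots> = (LINT t:{a..b}|torus. f t)"
        by (simp add: torus_def set_lebesgue_integral_def integral_restrict_space)
      also have "\<dots> = 0"
      proof (cases "a < b")
        case True then show ?thesis using zero ab by simp
      next
        case False
        then have "{a..b} \<subseteq> {a}" by auto
        then have "AE t in lebesgue. t \<notin> {a..b}"
          by (intro AE_not_in) (metis negligible_sing negligible_subset negligible_iff_null_sets)
        then have "AE t in torus. t \<notin> {a..b}"
          unfolding torus_def by (auto simp: AE_restrict_space_iff)
        then have "AE t in torus. indicator {a..b} t *\<^sub>R f t = 0"
          by eventually_elim simp
        then show ?thesis unfolding set_lebesgue_integral_def by (rule integral_eq_zero_AE)
      qed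
      finally show ?thesis .
    qed
    ultimately have "(\<lambda>n::nat. 0) \<longlonglongrightarrow> (LINT t:{p<..<q}|lebesgue. h t)" by (simp add: eq)
    then show "(LINT t:{p<..<q}|lebesgue. h t) = 0" by (simp add: LIMSEQ_const_iff)
  qed
  then have "AE t in torus. h t = 0" unfolding torus_def by (auto simp: AE_restrict_space_iff)
  then show ?thesis by eventually_elim (auto simp: h_def)
qed

section \<open>Uniqueness of Fourier coefficients\<close>

text \<open>
  The class of bounded \<open>h\<close> for which every Fourier coefficient of \<open>f h\<close> is \<open>0\<close>. It is stable under
  linear combinations and under multiplication by characters. Working with all \<open>h\<close> at once, instead of
  \<open>h = 1\<close>, makes the induction over products of polynomials go through.
\<close>

definition annihilated_by_all_characters :: "(real \<Rightarrow> complex) \<Rightarrow> (real \<Rightarrow> complex) \<Rightarrow> bool" where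
  "annihilated_by_all_characters f h \<longleftrightarrow> h \<in> borel_measurable torus \<and> (\<exists>B. \<forall>t. cmod (h t) \<le> B) \<and>
     (\<forall>m. (LINT t|torus. f t * h t * torus_char m t) = 0)"

context
  fixes f :: "real \<Rightarrow> complex"
  assumes f: "integrable torus f"
begin

lemma annihilated_integrable:
  assumes "annihilated_by_all_characters f h"
  shows "integrable torus (\<lambda>t. f t * h t)" "integrable torus (\<lambda>t. f t * h t * torus_char m t)"
proof -
  obtain B where "\<And>t. cmod (h t) \<le> B" "h \<in> borel_measurable torus"
    using assms by (auto simp: annihilated_by_all_characters_def)
  then show "integrable torus (\<lambda>t. f t * h t)"
    by (intro integrable_torus_bounded_mult[OF f, of h B]) auto
  then show "integrable torus (\<lambda>t. f t * h t * torus_char m t)"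
    by (rule integrable_mult_torus_char)
qed

lemma annihilated_add:
  assumes g: "annihilated_by_all_characters f g" and h: "annihilated_by_all_characters f h"
  shows "annihilated_by_all_characters f (\<lambda>t. g t + h t)"
proof -
  obtain B C where B: "\<And>t. cmod (g t) \<le> B" and C: "\<And>t. cmod (h t) \<le> C"
    using g h by (auto simp: annihilated_by_all_characters_def)
  have "cmod (g t + h t) \<le> B + C" for t
    using norm_triangle_ineq[of "g t" "h t"] B[of t] C[of t] by linarith
  moreover have "(LINT t|torus. f t * (g t + h t) * torus_char m t) = 0" for m
  proof -
    have "(LINT t|torus. f t * (g t + h t) * torus_char m t) =
       (LINT t|torus. f t * g t * torus_char m t + f t * h t * torus_char m t)"
      by (simp add: algebra_simps)
    also have "\<dots> = 0"
      using annihilated_integrable(2)[OF g, of m] annihilated_integrable(2)[OF h, of m] g h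
      by (simp add: annihilated_by_all_characters_def)
    finally show ?thesis .
  qed
  ultimately show ?thesis
    using g h unfolding annihilated_by_all_characters_def by (auto intro!: borel_measurable_add)
qed

lemma annihilated_mult_char:
  assumes h: "annihilated_by_all_characters f h"
  shows "annihilated_by_all_characters f (\<lambda>t. a * torus_char k t * h t)"
proof -
  obtain B where B: "\<And>t. cmod (h t) \<le> B"
    using h by (auto simp: annihilated_by_all_characters_def)
  have "cmod (a * torus_char k t * h t) \<le> cmod a * B" for t
    using B[of t] by (auto simp: norm_mult intro: mult_left_mono)
  moreover have "(LINT t|torus. f t * (a * torus_char k t * h t) * torus_char m t) = 0" for m
  proof -
    have "(LINT t|torus. f t * (a * torus_char k t * h t) * torus_char m t)
      = (LINT t|torus. a * (f t * h t * torus_char (k + m) t))"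
      by (simp add: torus_char_add ac_simps)
    also have "\<dots> = 0"
      using h by (simp add: annihilated_by_all_characters_def)
    finally show ?thesis .
  qed
  moreover have "(\<lambda>t. a * torus_char k t * h t) \<in> borel_measurable torus"
    using h unfolding annihilated_by_all_characters_def by (intro borel_measurable_times) auto
  ultimately show ?thesis
    unfolding annihilated_by_all_characters_def by blast
qed

text \<open>
  A real-linear function of \<open>cis t\<close> is a combination of the characters of frequency \<open>1\<close> and \<open>-1\<close>; a
  product of two polynomials acts by multiplying with one factor after the other.
\<close>

lemma annihilated_mult_polynomial:
  assumes "real_polynomial_function p" "annihilated_by_all_characters f h"
  shows "annihilated_by_all_characters f (\<lambda>t. of_real (p (cis t)) * h t)"
  using assms
proof (induction arbitrary: h)
  case (linear p)
  interpret bounded_linear p by fact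
  define a b where "a = p 1" and "b = p \<i>"
  have "of_real (p (cis t)) = (of_real a - \<i> * of_real b) / 2 * torus_char 1 t + (of_real a + \<i> * of_real b) / 2 * torus_char (-1) t" for t
  proof -
    have "cis t = cos t *\<^sub>R 1 + sin t *\<^sub>R \<i>" by (simp add: complex_eq_iff)
    then have "p (cis t) = cos t * a + sin t * b"
      by (simp only: add scaleR a_def b_def) simp
    then show ?thesis by (simp add: torus_char_def complex_eq_iff) (simp add: field_simps)
  qed
  then have "(\<lambda>t. of_real (p (cis t)) * h t) =
     (\<lambda>t. (of_real a - \<i> * of_real b) / 2 * torus_char 1 t * h t + (of_real a + \<i> * of_real b) / 2 * torus_char (-1) t * h t)"
    by (simp add: algebra_simps)
  then show ?case using linear.prems by (simp only:) (intro annihilated_add annihilated_mult_char)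
next
  case (const c)
  then show ?case using annihilated_mult_char[of h "of_real c" 0] by simp
next
  case (add p q)
  then have "annihilated_by_all_characters f (\<lambda>t. of_real (p (cis t)) * h t + of_real (q (cis t)) * h t)"
    by (intro annihilated_add) auto
  then show ?case by (simp add: algebra_simps)
next
  case (mult p q)
  have "annihilated_by_all_characters f (\<lambda>t. of_real (p (cis t)) * (of_real (q (cis t)) * h t))"
    by (intro mult)
  then show ?case by (simp add: mult_ac)
qed

context
  assumes coeff: "\<And>m. PW_transform f m 0 = 0"
begin

text \<open>
  By the Stone--Weierstrass theorem \<open>\<phi>\<close> is uniformly close on the circle to a polynomial, against
  which \<open>f\<close> integrates to \<open>0\<close>.
\<close>

lemma integral_continuous_on_circle_eq_0:
  fixes \<phi> :: "complex \<Rightarrow> real"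
  assumes \<phi>: "continuous_on UNIV \<phi>"
  shows "(LINT t|torus. f t * of_real (\<phi> (cis t))) = 0"
proof -
  \<comment> \<open>The approximation error in the integral is at most \<open>e L\<close> for every \<open>e > 0\<close>.\<close>
  define L where "L = (LINT t|torus. cmod (f t))"
  have L0: "L \<ge> 0" by (simp add: L_def Bochner_Integration.integral_nonneg)
  have one: "annihilated_by_all_characters f (\<lambda>_. 1)"
    using coeff by (auto simp: annihilated_by_all_characters_def PW_transform_row_0)
  have cm: "(\<lambda>t. complex_of_real (\<phi> (cis t))) \<in> borel_measurable torus"
    by (intro measurable_torus_continuous continuous_intros continuous_on_compose2[OF \<phi>]) auto
  have bound: "cmod (LINT t|torus. f t * of_real (\<phi> (cis t))) \<le> e * L" if e0: "e > 0" for e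
  proof -
    obtain p where p: "real_polynomial_function p" "\<And>w. w \<in> sphere 0 1 \<Longrightarrow> \<bar>\<phi> w - p w\<bar> < e"
      using Stone_Weierstrass_real_polynomial_function[OF compact_sphere continuous_on_subset[OF \<phi> subset_UNIV] e0]
      by metis
    have pa: "annihilated_by_all_characters f (\<lambda>t. of_real (p (cis t)))"
      using annihilated_mult_polynomial[OF p(1) one] by simp
    have e: "cmod (of_real (\<phi> (cis t)) - of_real (p (cis t))) \<le> e" for t
      using p(2)[of "cis t"] by (simp flip: of_real_diff)
    have di: "integrable torus (\<lambda>t. f t * (of_real (\<phi> (cis t)) - of_real (p (cis t))))"
      using e pa cm by (intro integrable_torus_bounded_mult[OF f, of _ e]) (auto simp: annihilated_by_all_characters_def)
    have "(LINT t|torus. f t * of_real (\<phi> (cis t))) =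
       (LINT t|torus. f t * (of_real (\<phi> (cis t)) - of_real (p (cis t))) + f t * of_real (p (cis t)))"
      by (simp add: algebra_simps)
    also have "\<dots> = (LINT t|torus. f t * (of_real (\<phi> (cis t)) - of_real (p (cis t))))"
      using di annihilated_integrable(1)[OF pa] pa[unfolded annihilated_by_all_characters_def, THEN conjunct2, THEN conjunct2, rule_format, of 0]
      by simp
    also have "cmod \<dots> \<le> (LINT t|torus. cmod (f t * (of_real (\<phi> (cis t)) - of_real (p (cis t)))))"
      by (rule integral_norm_bound)
    also have "\<dots> \<le> (LINT t|torus. e * cmod (f t))"
    proof (rule integral_mono)
      show "cmod (f t * (of_real (\<phi> (cis t)) - of_real (p (cis t)))) \<le> e * cmod (f t)" for t
        unfolding norm_mult mult.commute[of e] by (intro mult_left_mono e norm_ge_zero)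
    qed (use f in \<open>auto intro: integrable_norm di\<close>)
    also have "\<dots> = e * L" by (simp add: L_def)
    finally show ?thesis .
  qed
  have "cmod (LINT t|torus. f t * of_real (\<phi> (cis t))) \<le> 0"
  proof (rule field_le_epsilon)
    fix e :: real assume e: "e > 0"
    have "cmod (LINT t|torus. f t * of_real (\<phi> (cis t))) \<le> e / (L + 1) * L"
      using e L0 by (intro bound) auto
    also have "\<dots> \<le> e" using e L0 by (simp add: field_simps)
    finally show "cmod (LINT t|torus. f t * of_real (\<phi> (cis t))) \<le> 0 + e" by simp
  qed
  then show ?thesis by simp
qed

text \<open>
  The indicator of the compact arc is the pointwise limit of continuous functions of the distance to
  the arc. Since \<open>-pi < p\<close> and \<open>q < pi\<close>, the arc avoids the point \<open>-1\<close>, at which the two ends of the torus meet.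
\<close>

lemma integral_closed_arc_eq_0:
  assumes pq: "-pi < p" "p < q" "q < pi"
  shows "(LINT t:{p..q}|torus. f t) = 0"
proof -
  define C where "C = cis ` {p..q}"
  have C: "compact C" "C \<noteq> {}"
    unfolding C_def using pq by (auto intro!: compact_continuous_image continuous_intros)
  have arc: "cis t \<in> C \<longleftrightarrow> t \<in> {p..q}" if "t \<in> {-pi..<pi}" for t
  proof
    assume "cis t \<in> C"
    then obtain s where s: "s \<in> {p..q}" "cis t = cis s" by (auto simp: C_def)
    have 1: "Arg (cis s) = s" using s pq by (intro cis_Arg_unique) (auto simp: sgn_cis)
    show "t \<in> {p..q}"
    \<comment> \<open>\<open>Arg\<close> takes values in \<open>(-pi, pi]\<close>, so it does not recover \<open>t = -pi\<close>, where \<open>cis t = cis pi\<close>.\<close>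
    proof (cases "t = -pi")
      case True
      have "Arg (cis t) = pi" unfolding True by (intro cis_Arg_unique) (auto simp: sgn_cis complex_eq_iff)
      then show ?thesis using s 1 pq by auto
    next
      case False
      then have "Arg (cis t) = t" using that by (intro cis_Arg_unique) (auto simp: sgn_cis)
      then show ?thesis using s 1 by auto
    qed
  qed (auto simp: C_def)
  define \<phi> where "\<phi> = (\<lambda>(n::nat) w. max 0 (1 - real n * infdist w C))"
  have cont: "continuous_on A (\<phi> n)" for A n
    unfolding \<phi>_def by (intro continuous_intros)
  have "(\<lambda>n. LINT t|torus. f t * of_real (\<phi> n (cis t))) \<longlonglongrightarrow> (LINT t|torus. indicator {p..q} t *\<^sub>R f t)"
  proof (rule integral_dominated_convergence[where w="\<lambda>t. norm (f t)"])
    show "AE t in torus. (\<lambda>n. f t * of_real (\<phi> n (cis t))) \<longlonglongrightarrow> indicator {p..q} t *\<^sub>R f t"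
    proof (intro AE_I2)
      fix t assume t: "t \<in> space torus"
      show "(\<lambda>n. f t * of_real (\<phi> n (cis t))) \<longlonglongrightarrow> indicator {p..q} t *\<^sub>R f t"
      proof (cases "cis t \<in> C")
        case True
        then have "\<phi> n (cis t) = 1" for n by (simp add: \<phi>_def)
        then show ?thesis using True t arc by simp
      next
        case False
        then have d: "infdist (cis t) C > 0"
          using C compact_imp_closed in_closed_iff_infdist_zero[of C "cis t"] infdist_nonneg[of "cis t" C] by force
        obtain N where N: "1 / infdist (cis t) C < real N" using reals_Archimedean2 by blast
        have "\<phi> n (cis t) = 0" if "n \<ge> N" for n
        proof -
          have "1 / infdist (cis t) C < real n" using N that by (meson less_le_trans of_nat_mono)
          then have "1 < real n * infdist (cis t) C" using d by (simp add: field_simps)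
          then show ?thesis by (simp add: \<phi>_def)
        qed
        then have "\<forall>\<^sub>F n in sequentially. f t * of_real (\<phi> n (cis t)) = indicator {p..q} t *\<^sub>R f t"
          unfolding eventually_sequentially using False t arc by (intro exI[of _ N]) auto
        then show ?thesis by (rule tendsto_eventually)
      qed
    qed
    show "(\<lambda>t. f t * of_real (\<phi> n (cis t))) \<in> borel_measurable torus" for n
      by (intro borel_measurable_times borel_measurable_integrable[OF f] measurable_torus_continuous
            continuous_intros continuous_on_compose2[OF cont]) auto
    show "AE t in torus. norm (f t * of_real (\<phi> n (cis t))) \<le> norm (f t)" for n
      by (intro AE_I2) (auto simp: \<phi>_def norm_mult infdist_nonneg intro!: mult_left_le)
    show "(\<lambda>t. indicator {p..q} t *\<^sub>R f t) \<in> borel_measurable torus"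
      using f pq by (intro borel_measurable_scaleR borel_measurable_indicator) (auto simp: torus_def sets_restrict_space_iff)
  qed (use f in auto)
  moreover have "(LINT t|torus. f t * of_real (\<phi> n (cis t))) = 0" for n
    by (intro integral_continuous_on_circle_eq_0 cont)
  ultimately have "(\<lambda>n::nat. 0) \<longlonglongrightarrow> (LINT t|torus. indicator {p..q} t *\<^sub>R f t)" by simp
  then show ?thesis by (simp add: set_lebesgue_integral_def LIMSEQ_const_iff)
qed

lemma Fourier_coefficients_0_imp_AE_0: "AE t in torus. f t = 0"
proof -
  have "AE t in torus. -pi < t \<and> t < pi \<longrightarrow> f t = 0"
    using f by (rule torus_AE_zero_on_interval) (auto intro: integral_closed_arc_eq_0)
  moreover have "AE t in torus. t \<noteq> -pi" by (rule AE_torus_neq)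
  moreover have "AE t in torus. -pi \<le> t \<and> t < pi" by (rule AE_I2) simp
  ultimately show ?thesis by eventually_elim auto
qed

end
end

section \<open>The Riesz-Fischer theorem and Parseval's identity\<close>

abbreviation symmetric_partial_sum :: "(int \<Rightarrow> complex) \<Rightarrow> nat \<Rightarrow> real \<Rightarrow> complex" where
  "symmetric_partial_sum c n \<equiv> trig_sum c {- int n..int n}"

lemma symmetric_sums_tendsto_infsum:
  fixes g :: "int \<Rightarrow> 'a::{topological_comm_monoid_add, t2_space}"
  assumes "g summable_on UNIV"
  shows "(\<lambda>n::nat. \<Sum>m=- int n..int n. g m) \<longlonglongrightarrow> infsum g UNIV"
proof -
  have "filterlim (\<lambda>n::nat. {- int n..int n}) (finite_subsets_at_top UNIV) sequentially"
    unfolding filterlim_finite_subsets_at_top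
  proof (intro allI impI)
    fix X :: "int set" assume X: "finite X \<and> X \<subseteq> UNIV"
    define N where "N = nat (Max (abs ` insert 0 X))"
    have "\<bar>x\<bar> \<le> int N" if "x \<in> X" for x
      unfolding N_def using that X by (auto intro: order_trans[OF Max_ge])
    then have "X \<subseteq> {- int n..int n}" if "n \<ge> N" for n
      using that by fastforce
    then show "\<forall>\<^sub>F n in sequentially. finite {- int n..int n} \<and> X \<subseteq> {- int n..int n} \<and> {- int n..int n} \<subseteq> UNIV"
      unfolding eventually_sequentially by auto
  qed
  then show ?thesis
    using has_sum_infsum[OF assms] unfolding has_sum_def by (rule filterlim_compose[rotated])
qed

lemma PW_transform_trig_sum:
  assumes "finite A"
  shows "PW_transform (trig_sum a A) m 0 = (if m \<in> A then a m else 0)"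
proof -
  have prod: "trig_sum a A t * torus_char m t = (\<Sum>k\<in>A. a k * torus_char (m - k) t)" for t
    unfolding trig_sum_def sum_distrib_right
    by (intro sum.cong refl) (simp add: diff_conv_add_uminus torus_char_add mult_ac del: add_uminus_conv_diff)
  have "(LINT t|torus. trig_sum a A t * torus_char m t) = (\<Sum>k\<in>A. a k * (if k = m then 2 * of_real pi else 0))"
  proof -
    have "(LINT t|torus. torus_char (m - k) t) = (if k = m then 2 * of_real pi else 0)" for k
      by (auto simp: integral_torus_char)
    then show ?thesis
      by (simp add: prod
          Bochner_Integration.integral_sum torus_integral_continuous(1) continuous_torus_char)
  qed
  also have "\<dots> = (if m \<in> A then 2 * of_real pi * a m else 0)"
    using assms by (simp add: if_distrib cong: if_cong)
  finally show ?thesis by (simp add: PW_transform_row_0)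
qed

lemma PW_transform_row_0_diff_bound:
  assumes "integrable torus f" "integrable torus g"
  shows "cmod (PW_transform f m 0 - PW_transform g m 0) \<le> (LINT t|torus. cmod (f t - g t))"
proof -
  have "PW_transform f m 0 - PW_transform g m 0 = 1 / (2 * of_real pi) * (LINT t|torus. (f t - g t) * torus_char m t)"
    using assms by (simp add: PW_transform_row_0 left_diff_distrib integrable_mult_torus_char right_diff_distrib diff_divide_distrib)
  then have "cmod (PW_transform f m 0 - PW_transform g m 0) = 1 / (2 * pi) * cmod (LINT t|torus. (f t - g t) * torus_char m t)"
    by (simp add: norm_mult norm_divide)
  also have "\<dots> \<le> 1 * (LINT t|torus. cmod ((f t - g t) * torus_char m t))"
    using pi_gt3 by (intro mult_mono integral_norm_bound) (auto simp: field_simps)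
  finally show ?thesis by (simp add: norm_mult)
qed

lemma symmetric_partial_sums_Cauchy:
  assumes c: "(\<lambda>m. (cmod (c m))\<^sup>2) summable_on UNIV" and d: "d > 0"
  shows "\<exists>N. \<forall>i\<ge>N. \<forall>j\<ge>N. (LINT t|torus. (cmod (symmetric_partial_sum c i t - symmetric_partial_sum c j t))\<^sup>2) < d"
proof -
  define \<sigma> where "\<sigma> = (\<lambda>n::nat. \<Sum>m=- int n..int n. (cmod (c m))\<^sup>2)"
  have "convergent \<sigma>"
    unfolding \<sigma>_def using symmetric_sums_tendsto_infsum[OF c] by (rule convergentI)
  then have "Cauchy \<sigma>" by (simp add: Cauchy_convergent_iff)
  then obtain N where N: "\<And>i j. i \<ge> N \<Longrightarrow> j \<ge> N \<Longrightarrow> \<bar>\<sigma> i - \<sigma> j\<bar> < d / (2 * pi)"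
    using d unfolding Cauchy_def dist_real_def by (metis divide_pos_pos mult_pos_pos pi_gt_zero zero_less_numeral)
  have le: "(LINT t|torus. (cmod (symmetric_partial_sum c i t - symmetric_partial_sum c j t))\<^sup>2) = 2 * pi * (\<sigma> i - \<sigma> j)"
    if "j \<le> i" for i j
  proof -
    let ?A = "{- int i..int i} - {- int j..int j}"
    have sub: "{- int j..int j} \<subseteq> {- int i..int i}" using that by auto
    have "symmetric_partial_sum c i t - symmetric_partial_sum c j t = trig_sum c ?A t" for t
      unfolding trig_sum_def by (subst sum_diff[OF _ sub]) auto
    then have "(LINT t|torus. (cmod (symmetric_partial_sum c i t - symmetric_partial_sum c j t))\<^sup>2) = 2 * pi * (\<Sum>m\<in>?A. (cmod (c m))\<^sup>2)"
      by (simp add: norm_trig_sum_square)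
    also have "(\<Sum>m\<in>?A. (cmod (c m))\<^sup>2) = \<sigma> i - \<sigma> j"
      unfolding \<sigma>_def by (subst sum_diff[OF _ sub]) auto
    finally show ?thesis .
  qed
  have "(LINT t|torus. (cmod (symmetric_partial_sum c i t - symmetric_partial_sum c j t))\<^sup>2) < d"
    if "i \<ge> N" "j \<ge> N" for i j
  proof -
    have lt: "2 * pi * (\<sigma> k - \<sigma> l) < d" if "k \<ge> N" "l \<ge> N" for k l
    proof -
      have "\<sigma> k - \<sigma> l < d / (2 * pi)" using N[OF that] by simp
      then show ?thesis by (simp add: field_simps)
    qed
    show ?thesis
    proof (cases "j \<le> i")
      case True then show ?thesis using le lt that by simp
    next
      case False
      then show ?thesis using le[of i j] lt[of j i] that by (simp add: norm_minus_commute)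
    qed
  qed
  then show ?thesis by blast
qed

text \<open>
  The partial sums are Cauchy in \<open>L\<^sup>2\<close>, hence in \<open>L\<^sup>1\<close>, so a subsequence converges almost everywhere to
  some \<open>f\<close>. Fatou's lemma turns the Cauchy estimate into \<open>L\<^sup>2\<close> convergence of the full sequence to \<open>f\<close>,
  and the coefficients of \<open>f\<close> are read off since they are continuous for the \<open>L\<^sup>1\<close> norm.
\<close>

theorem Riesz_Fischer:
  assumes c: "(\<lambda>m. (cmod (c m))\<^sup>2) summable_on UNIV"
  obtains f where "f \<in> L2_torus" "\<And>m. PW_transform f m 0 = c m"
    "(\<lambda>n. LINT t|torus. (cmod (f t - symmetric_partial_sum c n t))\<^sup>2) \<longlonglongrightarrow> 0"
proof -
  define S where "S = symmetric_partial_sum c"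
  have S: "S n \<in> L2_torus" for n by (simp add: S_def trig_sum_L2)
  have [measurable]: "S n \<in> borel_measurable torus" for n using S by (simp add: L2_torus_def)
  have "\<exists>N. \<forall>i\<ge>N. \<forall>j\<ge>N. (LINT t|torus. cmod (S i t - S j t)) < e" if "e > 0" for e
  proof -
    obtain d where d: "d > 0" "\<And>f. f \<in> L2_torus \<Longrightarrow> (LINT t|torus. (cmod (f t))\<^sup>2) < d \<Longrightarrow> (LINT t|torus. cmod (f t)) < e"
      using L1_small_if_L2_small[OF \<open>e > 0\<close>] by blast
    show ?thesis
      using symmetric_partial_sums_Cauchy[OF c d(1)] d(2)[OF L2_torus_diff[OF S S]] unfolding S_def by meson
  qed
  then obtain r where r: "strict_mono r" "AE t in torus. Cauchy (\<lambda>i. S (r i) t)"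
    using cauchy_L1_AE_cauchy_subseq[of torus S] L2_torus_integrable[OF S] by metis
  define f where "f = (\<lambda>t. lim (\<lambda>i. S (r i) t))"
  have [measurable]: "f \<in> borel_measurable torus"
    unfolding f_def by (intro borel_measurable_lim_metric) simp
  have lim: "AE t in torus. (\<lambda>i. S (r i) t) \<longlonglongrightarrow> f t"
    using r(2) by eventually_elim (simp add: f_def Cauchy_convergent convergent_LIMSEQ_iff flip: convergent_LIMSEQ_iff)
  have tail: "f \<in> L2_torus \<and> (LINT t|torus. (cmod (f t - S n t))\<^sup>2) \<le> d"
    if d: "d > 0" and N: "\<And>i j. i \<ge> N \<Longrightarrow> j \<ge> N \<Longrightarrow> (LINT t|torus. (cmod (S i t - S j t))\<^sup>2) < d" and n: "n \<ge> N" for d n N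
  proof -
    have "(\<integral>\<^sup>+ t. ennreal ((cmod (f t - S n t))\<^sup>2) \<partial>torus)
        = (\<integral>\<^sup>+ t. liminf (\<lambda>i. ennreal ((cmod (S (r i) t - S n t))\<^sup>2)) \<partial>torus)"
    proof (rule nn_integral_cong_AE)
      show "AE t in torus. ennreal ((cmod (f t - S n t))\<^sup>2) = liminf (\<lambda>i. ennreal ((cmod (S (r i) t - S n t))\<^sup>2))"
        using lim
      proof eventually_elim
        case (elim t)
        then have "(\<lambda>i. ennreal ((cmod (S (r i) t - S n t))\<^sup>2)) \<longlonglongrightarrow> ennreal ((cmod (f t - S n t))\<^sup>2)"
          by (intro tendsto_intros)
        then show ?case using lim_imp_Liminf trivial_limit_sequentially by metis
      qed
    qed
    also have "\<dots> \<le> liminf (\<lambda>i. \<integral>\<^sup>+ t. ennreal ((cmod (S (r i) t - S n t))\<^sup>2) \<partial>torus)"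
      by (intro nn_integral_liminf) measurable
    also have "\<dots> \<le> liminf (\<lambda>i::nat. ennreal d)"
    proof (rule Liminf_mono)
      show "\<forall>\<^sub>F i in sequentially. (\<integral>\<^sup>+ t. ennreal ((cmod (S (r i) t - S n t))\<^sup>2) \<partial>torus) \<le> ennreal d"
        using eventually_ge_at_top[of N]
      proof eventually_elim
        case (elim i)
        then have "r i \<ge> N" using seq_suble[OF r(1), of i] by simp
        then show ?case
          using L2_torus_square_integrable[OF L2_torus_diff[OF S S, of "r i" n]] N[of "r i" n] n
          by (subst nn_integral_eq_integral) (auto intro!: ennreal_leI)
      qed
    qed
    also have "\<dots> = ennreal d" by (simp add: Liminf_const)
    finally have nn: "(\<integral>\<^sup>+ t. ennreal ((cmod (f t - S n t))\<^sup>2) \<partial>torus) \<le> ennreal d" .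
    have int: "integrable torus (\<lambda>t. (cmod (f t - S n t))\<^sup>2)"
      using nn by (intro integrableI_bounded) (auto simp: le_less_trans[OF _ ennreal_less_top])
    then have "(\<lambda>t. f t - S n t) \<in> L2_torus" by (simp add: L2_torus_def)
    then have "(\<lambda>t. (f t - S n t) - (0 - S n t)) \<in> L2_torus"
      by (rule L2_torus_diff[OF _ L2_torus_diff[OF L2_torus_continuous[OF continuous_on_const] S]])
    moreover have "(LINT t|torus. (cmod (f t - S n t))\<^sup>2) \<le> d"
      using nn d int by (simp add: nn_integral_eq_integral)
    ultimately show ?thesis by simp
  qed
  have fL: "f \<in> L2_torus"
    using symmetric_partial_sums_Cauchy[OF c zero_less_one] tail[OF zero_less_one] unfolding S_def by blast
  have conv: "(\<lambda>n. LINT t|torus. (cmod (f t - S n t))\<^sup>2) \<longlonglongrightarrow> 0"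
  proof (rule LIMSEQ_I)
    fix e :: real assume "e > 0"
    then have e2: "e / 2 > 0" by simp
    obtain N where "\<And>i j. i \<ge> N \<Longrightarrow> j \<ge> N \<Longrightarrow> (LINT t|torus. (cmod (S i t - S j t))\<^sup>2) < e / 2"
      using symmetric_partial_sums_Cauchy[OF c e2] unfolding S_def by blast
    from tail[OF e2 this] have le: "(LINT t|torus. (cmod (f t - S n t))\<^sup>2) \<le> e / 2" if "n \<ge> N" for n using that by blast
    then show "\<exists>N. \<forall>n\<ge>N. norm ((LINT t|torus. (cmod (f t - S n t))\<^sup>2) - 0) < e"
    proof (intro exI[of _ N] allI impI)
      fix n assume "n \<ge> N"
      then show "norm ((LINT t|torus. (cmod (f t - S n t))\<^sup>2) - 0) < e"
        using le[of n] \<open>e > 0\<close> by (simp add: abs_of_nonneg Bochner_Integration.integral_nonneg)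
    qed
  qed
  have coeff: "PW_transform f m 0 = c m" for m
  proof -
    have "cmod (PW_transform f m 0 - c m) \<le> 0"
    proof (rule field_le_epsilon)
      fix e :: real assume "e > 0"
      then obtain d where d: "d > 0" "\<And>f. f \<in> L2_torus \<Longrightarrow> (LINT t|torus. (cmod (f t))\<^sup>2) < d \<Longrightarrow> (LINT t|torus. cmod (f t)) < e"
        using L1_small_if_L2_small by blast
      have "\<forall>\<^sub>F n in sequentially. (LINT t|torus. (cmod (f t - S n t))\<^sup>2) < d"
        using conv d(1) by (rule order_tendstoD)
      then have "\<forall>\<^sub>F n in sequentially. nat \<bar>m\<bar> \<le> n \<and> (LINT t|torus. (cmod (f t - S n t))\<^sup>2) < d"
        using eventually_ge_at_top by eventually_elim simp
      then obtain n where n: "nat \<bar>m\<bar> \<le> n" "(LINT t|torus. (cmod (f t - S n t))\<^sup>2) < d"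
        unfolding eventually_sequentially by blast
      have "m \<in> {- int n..int n}" using n(1) by auto
      then have "PW_transform (S n) m 0 = c m" by (simp add: S_def PW_transform_trig_sum)
      then have "cmod (PW_transform f m 0 - c m) \<le> (LINT t|torus. cmod (f t - S n t))"
        using PW_transform_row_0_diff_bound[OF L2_torus_integrable[OF fL] L2_torus_integrable[OF S], of m n] by simp
      also have "\<dots> < e" using d(2)[OF L2_torus_diff[OF fL S] n(2)] .
      finally show "cmod (PW_transform f m 0 - c m) \<le> 0 + e" by simp
    qed
    then show ?thesis by simp
  qed
  show thesis using that[OF fL coeff] conv by (simp add: S_def)
qed

text \<open>
  The function that \<open>Riesz_Fischer\<close> reconstructs from the coefficients of \<open>f\<close> has the same coefficients
  as \<open>f\<close>, so it is \<open>f\<close> almost everywhere and the partial sums converge to \<open>f\<close> in \<open>L\<^sup>2\<close>. The sum of squares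
  is then the limit in Bessel's identity.
\<close>

theorem Parseval:
  assumes f: "f \<in> L2_torus"
  shows "(\<lambda>m. (cmod (PW_transform f m 0))\<^sup>2) summable_on UNIV"
    and "(\<Sum>\<^sub>\<infinity>m. (cmod (PW_transform f m 0))\<^sup>2) = 1 / (2 * pi) * (LINT t|torus. (cmod (f t))\<^sup>2)"
    and "(\<lambda>n. LINT t|torus. (cmod (f t - symmetric_partial_sum (\<lambda>m. PW_transform f m 0) n t))\<^sup>2) \<longlonglongrightarrow> 0"
proof -
  define c where "c = (\<lambda>m. PW_transform f m 0)"
  define I where "I = (LINT t|torus. (cmod (f t))\<^sup>2)"
  have bound: "(\<Sum>m\<in>A. (cmod (c m))\<^sup>2) \<le> I / (2 * pi)" if "finite A" for A
    using Bessel_inequality[OF f that] by (simp add: c_def I_def field_simps)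
  have sm: "(\<lambda>m. (cmod (c m))\<^sup>2) summable_on UNIV"
    by (rule nonneg_bdd_above_summable_on) (auto intro!: bdd_aboveI2[where M="I / (2 * pi)"] bound)
  then show "(\<lambda>m. (cmod (PW_transform f m 0))\<^sup>2) summable_on UNIV" by (simp add: c_def)
  obtain g where g: "g \<in> L2_torus" "\<And>m. PW_transform g m 0 = c m"
      "(\<lambda>n. LINT t|torus. (cmod (g t - symmetric_partial_sum c n t))\<^sup>2) \<longlonglongrightarrow> 0"
    using Riesz_Fischer[OF sm] by blast
  have fi: "integrable torus f" and gi: "integrable torus g"
    using f g L2_torus_integrable by auto
  have "AE t in torus. f t - g t = 0"
  proof (rule Fourier_coefficients_0_imp_AE_0)
    show "integrable torus (\<lambda>t. f t - g t)" using fi gi by simp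
    show "PW_transform (\<lambda>t. f t - g t) m 0 = 0" for m
      using g(2)[of m] integrable_mult_torus_char[OF fi, of m] integrable_mult_torus_char[OF gi, of m]
      by (simp add: PW_transform_row_0 c_def left_diff_distrib)
  qed
  then have "(LINT t|torus. (cmod (f t - symmetric_partial_sum c n t))\<^sup>2) = (LINT t|torus. (cmod (g t - symmetric_partial_sum c n t))\<^sup>2)" for n
    using L2_torus_square_integrable[OF L2_torus_diff[OF f trig_sum_L2, of c "{- int n..int n}"]]
      L2_torus_square_integrable[OF L2_torus_diff[OF g(1) trig_sum_L2, of c "{- int n..int n}"]]
    by (intro integral_cong_AE) auto
  then have conv: "(\<lambda>n. LINT t|torus. (cmod (f t - symmetric_partial_sum c n t))\<^sup>2) \<longlonglongrightarrow> 0"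
    using g(3) by simp
  then show "(\<lambda>n. LINT t|torus. (cmod (f t - symmetric_partial_sum (\<lambda>m. PW_transform f m 0) n t))\<^sup>2) \<longlonglongrightarrow> 0"
    by (simp add: c_def)
  have "(\<lambda>n. I - 2 * pi * (\<Sum>m=- int n..int n. (cmod (c m))\<^sup>2)) \<longlonglongrightarrow> 0"
    using conv by (simp add: Bessel_identity[OF f] c_def I_def)
  moreover have "(\<lambda>n. I - 2 * pi * (\<Sum>m=- int n..int n. (cmod (c m))\<^sup>2)) \<longlonglongrightarrow> I - 2 * pi * (\<Sum>\<^sub>\<infinity>m. (cmod (c m))\<^sup>2)"
    by (intro tendsto_intros symmetric_sums_tendsto_infsum sm)
  ultimately have "I - 2 * pi * (\<Sum>\<^sub>\<infinity>m. (cmod (c m))\<^sup>2) = 0"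
    using LIMSEQ_unique by blast
  then show "(\<Sum>\<^sub>\<infinity>m. (cmod (PW_transform f m 0))\<^sup>2) = 1 / (2 * pi) * (LINT t|torus. (cmod (f t))\<^sup>2)"
    by (simp add: c_def I_def field_simps)
qed

section \<open>Discrete exponentials on the set D\<close>

definition growth_rate :: "real \<Rightarrow> real" where
  "growth_rate \<alpha> = cmod (discrete_exp (- \<alpha>) 0 1)"

lemma discrete_exp_0_1: "discrete_exp t 0 1 = (1 + \<i> * cis t) / (\<i> + cis t)"
  unfolding discrete_exp_def cis_conv_exp by simp

lemma discrete_exp_eq: "discrete_exp t m n = torus_char m t * discrete_exp t 0 1 powi n"
  unfolding discrete_exp_row_0[symmetric] discrete_exp_def by simp

lemma norm_1_plus_i_cis: "(cmod (1 + \<i> * cis t))\<^sup>2 = 2 - 2 * sin t"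
proof -
  have "(cmod (1 + \<i> * cis t))\<^sup>2 = (1 - sin t)\<^sup>2 + (cos t)\<^sup>2"
    by (simp add: cmod_power2)
  also have "\<dots> = 2 - 2 * sin t"
    by (simp add: cos_squared_eq power2_diff)
  finally show ?thesis .
qed

lemma norm_i_plus_cis: "(cmod (\<i> + cis t))\<^sup>2 = 2 + 2 * sin t"
proof -
  have "(cmod (\<i> + cis t))\<^sup>2 = (1 + sin t)\<^sup>2 + (cos t)\<^sup>2"
    by (simp add: cmod_power2)
  also have "\<dots> = 2 + 2 * sin t"
    by (simp add: cos_squared_eq power2_sum)
  finally show ?thesis .
qed

lemma norm_discrete_exp_0_1: "(cmod (discrete_exp t 0 1))\<^sup>2 = (1 - sin t) / (1 + sin t)"
proof -
  have "(cmod (discrete_exp t 0 1))\<^sup>2 = (2 * (1 - sin t)) / (2 * (1 + sin t))"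
    unfolding discrete_exp_0_1 norm_divide power_divide norm_1_plus_i_cis norm_i_plus_cis by simp
  also have "\<dots> = (1 - sin t) / (1 + sin t)"
    by (rule mult_divide_mult_cancel_left) simp
  finally show ?thesis .
qed

lemma borel_measurable_discrete_exp: "(\<lambda>t. discrete_exp t m n) \<in> borel_measurable torus"
proof -
  have [measurable]: "(\<lambda>t. discrete_exp t 0 1) \<in> borel_measurable torus"
    unfolding discrete_exp_0_1
    by (intro borel_measurable_divide measurable_torus_continuous continuous_intros)
  have "(\<lambda>t. discrete_exp t 0 1 powi n) \<in> borel_measurable torus"
    unfolding power_int_def by (cases "n \<ge> 0") simp_all
  then show ?thesis
    by (subst discrete_exp_eq) measurable
qed

context
  fixes \<alpha> :: real
  assumes \<alpha>: "0 < \<alpha>" "\<alpha> < pi / 2"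
begin

lemma sin_between_0_and_1: "0 < sin \<alpha>" "sin \<alpha> < 1"
proof -
  show "0 < sin \<alpha>" using \<alpha> by (intro sin_gt_zero) auto
  have "sin \<alpha> < sin (pi / 2)" using \<alpha> by (intro sin_monotone_2pi) auto
  then show "sin \<alpha> < 1" by simp
qed

lemma growth_rate_square: "(growth_rate \<alpha>)\<^sup>2 = (1 + sin \<alpha>) / (1 - sin \<alpha>)"
  unfolding growth_rate_def norm_discrete_exp_0_1 by simp

lemma growth_rate_nonneg: "0 \<le> growth_rate \<alpha>"
  by (simp add: growth_rate_def)

lemma growth_rate_ge_1: "1 \<le> growth_rate \<alpha>"
proof -
  have "1 \<le> (growth_rate \<alpha>)\<^sup>2"
    using sin_between_0_and_1 by (simp add: growth_rate_square field_simps)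
  then show ?thesis using one_le_power[of "growth_rate \<alpha>" 2]
    by (metis growth_rate_def norm_ge_zero one_power2 power2_le_imp_le)
qed

lemma sin_le_on_D: "t \<in> D \<alpha> \<Longrightarrow> \<bar>sin t\<bar> \<le> sin \<alpha>"
proof -
  assume t: "t \<in> D \<alpha>"
  have "\<bar>sin t\<bar> = sin \<bar>t\<bar>"
    using t sin_ge_zero[of "\<bar>t\<bar>"] by (cases "t \<ge> 0") (auto simp: D_def)
  also have "\<dots> \<le> sin \<alpha>"
  proof (cases "\<bar>t\<bar> \<le> \<alpha>")
    case True
    then show ?thesis using \<alpha> by (intro sin_monotone_2pi_le) auto
  next
    case False
    then have *: "pi - \<alpha> \<le> \<bar>t\<bar>" "\<bar>t\<bar> \<le> pi" using t by (auto simp: D_def)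
    have "sin \<bar>t\<bar> = sin (pi - \<bar>t\<bar>)" by simp
    also have "\<dots> \<le> sin \<alpha>" using * \<alpha> by (intro sin_monotone_2pi_le) auto
    finally show ?thesis .
  qed
  finally show ?thesis .
qed

lemma discrete_exp_0_1_on_D:
  assumes t: "t \<in> D \<alpha>"
  shows "discrete_exp t 0 1 \<noteq> 0" "\<i> + cis t \<noteq> 0"
    and "cmod (discrete_exp t 0 1) \<le> growth_rate \<alpha>" "inverse (cmod (discrete_exp t 0 1)) \<le> growth_rate \<alpha>"
proof -
  have s: "- sin \<alpha> \<le> sin t" "sin t \<le> sin \<alpha>" "-1 < sin t" "sin t < 1"
    using sin_le_on_D[OF t] sin_between_0_and_1 by auto
  have "(cmod (discrete_exp t 0 1))\<^sup>2 > 0" using s by (simp add: norm_discrete_exp_0_1)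
  then show "discrete_exp t 0 1 \<noteq> 0" by auto
  have "(cmod (\<i> + cis t))\<^sup>2 > 0" using s by (simp add: norm_i_plus_cis)
  then show "\<i> + cis t \<noteq> 0" by auto
  have "(1 - sin t) / (1 + sin t) \<le> (1 + sin \<alpha>) / (1 - sin \<alpha>)"
    using s sin_between_0_and_1 by (intro frac_le) auto
  then show "cmod (discrete_exp t 0 1) \<le> growth_rate \<alpha>"
    unfolding norm_discrete_exp_0_1[symmetric] growth_rate_square[symmetric]
    by (rule power2_le_imp_le[OF _ growth_rate_nonneg])
  have "(1 + sin t) / (1 - sin t) \<le> (1 + sin \<alpha>) / (1 - sin \<alpha>)"
    using s sin_between_0_and_1 by (intro frac_le) auto
  then show "inverse (cmod (discrete_exp t 0 1)) \<le> growth_rate \<alpha>"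
  proof (intro power2_le_imp_le[OF _ growth_rate_nonneg])
    assume "(1 + sin t) / (1 - sin t) \<le> (1 + sin \<alpha>) / (1 - sin \<alpha>)"
    then show "(inverse (cmod (discrete_exp t 0 1)))\<^sup>2 \<le> (growth_rate \<alpha>)\<^sup>2"
      unfolding power_inverse norm_discrete_exp_0_1 growth_rate_square by simp
  qed
qed

lemma norm_discrete_exp_on_D:
  assumes t: "t \<in> D \<alpha>"
  shows "cmod (discrete_exp t m n) \<le> growth_rate \<alpha> powi \<bar>n\<bar>"
proof -
  note b = discrete_exp_0_1_on_D[OF t]
  have "cmod (discrete_exp t m n) = cmod (discrete_exp t 0 1) powi n"
    by (subst discrete_exp_eq) (simp add: norm_mult norm_power_int)
  also have "\<dots> \<le> growth_rate \<alpha> powi \<bar>n\<bar>"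
  proof (cases "n \<ge> 0")
    case True
    then show ?thesis using b by (simp add: power_int_def power_mono)
  next
    case False
    then have "cmod (discrete_exp t 0 1) powi n = inverse (cmod (discrete_exp t 0 1)) ^ nat (-n)"
      by (simp add: power_int_def)
    also have "\<dots> \<le> growth_rate \<alpha> ^ nat (-n)" using b by (intro power_mono) auto
    also have "\<dots> = growth_rate \<alpha> powi \<bar>n\<bar>" using False by (simp add: power_int_def)
    finally show ?thesis .
  qed
  finally show ?thesis .
qed

text \<open>
  With \<open>L = discrete_exp t 0 1\<close> and \<open>w = cis t\<close> the equation is \<open>w L - 1 = - \<i> (L - w)\<close>, which is
  \<open>(\<i> + w) L = 1 + \<i> w\<close>. This is the reason for the form of \<open>discrete_exp\<close>.
\<close>

lemma discrete_exp_entire_on_D: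
  assumes t: "t \<in> D \<alpha>"
  shows "discrete_exp t (m + 1) (n + 1) - discrete_exp t m n =
    - \<i> * (discrete_exp t m (n + 1) - discrete_exp t (m + 1) n)"
proof -
  define w L where "w = cis t" and "L = discrete_exp t 0 1"
  have nz: "L \<noteq> 0" "\<i> + w \<noteq> 0"
    using discrete_exp_0_1_on_D[OF t] by (auto simp: w_def L_def)
  have L: "(\<i> + w) * L = 1 + \<i> * w"
    using nz unfolding L_def discrete_exp_0_1 w_def by simp
  have char_1: "torus_char 1 t = w" by (simp add: torus_char_def w_def)
  have e: "discrete_exp t m (n + 1) = torus_char m t * L powi n * L" "discrete_exp t (m + 1) k = torus_char m t * w * L powi k"
    "discrete_exp t m n = torus_char m t * L powi n" for k
    using nz by (auto simp: discrete_exp_eq[of t _ "n + 1"] discrete_exp_eq[of t "_ + 1"] discrete_exp_eq[of t m n]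
        L_def[symmetric] power_int_add torus_char_add char_1)
  have "w * L - 1 = - \<i> * (L - w)" using L by (simp add: algebra_simps)
  then have "torus_char m t * L powi n * (w * L - 1) = torus_char m t * L powi n * (- \<i> * (L - w))"
    by simp
  then show ?thesis unfolding e using nz by (simp add: power_int_add algebra_simps)
qed

lemma PW_transform_integrand_integrable:
  assumes f: "integrable torus f" and supp: "supp_subset f (D \<alpha>)"
  shows "integrable torus (\<lambda>t. f t * discrete_exp t m n)"
proof (rule integrable_torus_bounded_mult[OF f borel_measurable_discrete_exp])
  show "AE t in torus. cmod (discrete_exp t m n) \<le> growth_rate \<alpha> powi \<bar>n\<bar> \<or> f t = 0"
    using supp unfolding supp_subset_def by eventually_elim (use norm_discrete_exp_on_D in blast)
qed

lemma PW_transform_entire: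
  assumes f: "integrable torus f" and supp: "supp_subset f (D \<alpha>)"
  shows "discrete_entire (PW_transform f)"
  unfolding discrete_entire_def
proof (intro allI)
  fix m n
  note int = PW_transform_integrand_integrable[OF f supp]
  let ?e = "\<lambda>m n. LINT t|torus. f t * discrete_exp t m n"
  have "?e (m + 1) (n + 1) - ?e m n
      = (LINT t|torus. f t * discrete_exp t (m + 1) (n + 1) - f t * discrete_exp t m n)"
    using int by simp
  also have "\<dots> = (LINT t|torus. - \<i> * (f t * discrete_exp t m (n + 1) - f t * discrete_exp t (m + 1) n))"
  proof (rule integral_cong_AE)
    show "AE t in torus. f t * discrete_exp t (m + 1) (n + 1) - f t * discrete_exp t m n
       = - \<i> * (f t * discrete_exp t m (n + 1) - f t * discrete_exp t (m + 1) n)"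
      using supp unfolding supp_subset_def
    proof eventually_elim
      case (elim t)
      show ?case
      proof (cases "t \<in> D \<alpha>")
        case True
        have "f t * (discrete_exp t (m + 1) (n + 1) - discrete_exp t m n) = f t * (- \<i> * (discrete_exp t m (n + 1) - discrete_exp t (m + 1) n))"
          by (simp only: discrete_exp_entire_on_D[OF True])
        then show ?thesis by (simp add: algebra_simps)
      qed (use elim in simp)
    qed
  qed (use int in auto)
  also have "\<dots> = - \<i> * (?e m (n + 1) - ?e (m + 1) n)"
    using int by simp
  finally show "PW_transform f (m + 1) (n + 1) - PW_transform f m n
      = - \<i> * (PW_transform f m (n + 1) - PW_transform f (m + 1) n)"
    unfolding PW_transform_def by (simp add: field_simps)
qed

lemma PW_transform_growth:
  assumes f: "integrable torus f" and supp: "supp_subset f (D \<alpha>)"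
  shows "cmod (PW_transform f m n) \<le> (LINT t|torus. cmod (f t)) * growth_rate \<alpha> powi \<bar>n\<bar>"
proof -
  have "cmod (LINT t|torus. f t * discrete_exp t m n) \<le> (LINT t|torus. cmod (f t * discrete_exp t m n))"
    by (rule integral_norm_bound)
  also have "\<dots> \<le> (LINT t|torus. growth_rate \<alpha> powi \<bar>n\<bar> * cmod (f t))"
  proof (rule integral_mono_AE)
    show "AE t in torus. cmod (f t * discrete_exp t m n) \<le> growth_rate \<alpha> powi \<bar>n\<bar> * cmod (f t)"
      using supp unfolding supp_subset_def
    proof eventually_elim
      case (elim t)
      show ?case
      proof (cases "t \<in> D \<alpha>")
        case True
        show ?thesis
          unfolding norm_mult mult.commute[of "growth_rate \<alpha> powi \<bar>n\<bar>"]
          by (intro mult_left_mono norm_discrete_exp_on_D True norm_ge_zero)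
      qed (use elim in simp)
    qed
  qed (use PW_transform_integrand_integrable[OF f supp] f in \<open>auto intro: integrable_norm\<close>)
  finally have *: "cmod (LINT t|torus. f t * discrete_exp t m n) \<le> growth_rate \<alpha> powi \<bar>n\<bar> * (LINT t|torus. cmod (f t))"
    by simp
  have "cmod (PW_transform f m n) \<le> 1 * cmod (LINT t|torus. f t * discrete_exp t m n)"
    unfolding PW_transform_def norm_mult using pi_gt3 by (intro mult_right_mono) (auto simp: norm_divide norm_mult)
  then show ?thesis using * by (simp add: mult.commute)
qed

theorem PW_transform_in_PW:
  assumes f: "f \<in> L2_torus" and supp: "supp_subset f (D \<alpha>)"
  shows "PW_transform f \<in> PW \<alpha>"
    and "PW_norm (PW_transform f) = (2 * pi) powr (- 1 / 2) * L2_torus_norm f"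
proof -
  have fi: "integrable torus f" by (rule L2_torus_integrable[OF f])
  define c where "c = (LINT t|torus. cmod (f t)) + 1"
  have "c > 0" by (simp add: c_def add_nonneg_pos Bochner_Integration.integral_nonneg)
  moreover have "cmod (PW_transform f m n) \<le> c * cmod (discrete_exp (- \<alpha>) 0 1) powi \<bar>n\<bar>" for m n
    using PW_transform_growth[OF fi supp, of m n] by (simp add: c_def growth_rate_def distrib_right add_increasing2)
  ultimately show "PW_transform f \<in> PW \<alpha>"
    using PW_transform_entire[OF fi supp] Parseval(1)[OF f] unfolding PW_def by blast
  show "PW_norm (PW_transform f) = (2 * pi) powr (- 1 / 2) * L2_torus_norm f"
    unfolding PW_norm_def L2_torus_norm_def Parseval(2)[OF f]
    by (simp add: real_sqrt_mult real_sqrt_divide powr_minus_divide powr_half_sqrt)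
qed

end

section \<open>Oscillatory integrals\<close>

text \<open>
  Integration by parts, as in the Riemann--Lebesgue lemma for \<open>C\<^sup>1\<close> functions. The explicit constant
  matters: it lets the amplitude \<open>g\<close> vary with the frequency. The term with \<open>g'\<close> is integrable as the
  difference of a derivative and a continuous function.
\<close>

lemma integral_cis_mult_bound:
  fixes g g' :: "real \<Rightarrow> complex"
  assumes k: "k \<noteq> 0" and pq: "p \<le> q"
    and g: "\<And>t. t \<in> {p..q} \<Longrightarrow> (g has_vector_derivative g' t) (at t)"
    and B: "\<And>t. t \<in> {p..q} \<Longrightarrow> cmod (g t) \<le> B" "\<And>t. t \<in> {p..q} \<Longrightarrow> cmod (g' t) \<le> B"
  shows "cmod (integral {p..q} (\<lambda>t. cis (k * t) * g t)) \<le> B * (2 + (q - p)) / \<bar>k\<bar>"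
proof -
  define h where "h = (\<lambda>t. cis (k * t) * g t / (\<i> * of_real k))"
  have B0: "B \<ge> 0" using B(1)[of p] pq by (smt (verit) atLeastAtMost_iff norm_ge_zero)
  have "(h has_vector_derivative cis (k * t) * g t + cis (k * t) * g' t / (\<i> * of_real k)) (at t within {p..q})"
    if t: "t \<in> {p..q}" for t
  proof -
    have "((\<lambda>t. cis (k * t)) has_vector_derivative (\<i> * of_real k * cis (k * t))) (at t within {p..q})"
      unfolding cis_conv_exp
      by (auto intro!: derivative_eq_intros has_vector_derivative_real_field simp: mult_ac)
    from has_vector_derivative_mult[OF this has_vector_derivative_at_within[OF g[OF t]]]
    have "((\<lambda>t. cis (k * t) * g t) has_vector_derivative (cis (k * t) * g' t + \<i> * of_real k * cis (k * t) * g t)) (at t within {p..q})" .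
    from has_vector_derivative_divide[OF this, of "\<i> * of_real k"] show ?thesis
      unfolding h_def using k by (simp add: add_divide_distrib add.commute)
  qed
  then have 1: "((\<lambda>t. cis (k * t) * g t + cis (k * t) * g' t / (\<i> * of_real k)) has_integral (h q - h p)) {p..q}"
    by (intro fundamental_theorem_of_calculus pq)
  have "continuous_on {p..q} g"
    by (intro continuous_at_imp_continuous_on ballI) (rule has_vector_derivative_continuous[OF g])
  then have "(\<lambda>t. cis (k * t) * g t) integrable_on {p..q}"
    by (intro integrable_continuous_interval continuous_intros)
  then have 2: "((\<lambda>t. cis (k * t) * g t) has_integral integral {p..q} (\<lambda>t. cis (k * t) * g t)) {p..q}"
    by (rule integrable_integral)
  define J where "J = integral {p..q} (\<lambda>t. cis (k * t) * g t)"
  have 3: "((\<lambda>t. cis (k * t) * g' t / (\<i> * of_real k)) has_integral ((h q - h p) - J)) (cbox p q)"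
    using has_integral_diff[OF 1 2] by (simp add: J_def)
  have "cmod (h q - h p - J) \<le> B / \<bar>k\<bar> * measure lborel (cbox p q)"
    using B B0 by (intro has_integral_bound[OF _ 3]) (auto simp: norm_mult norm_divide intro!: divide_right_mono)
  then have "cmod (h q - h p - J) \<le> B / \<bar>k\<bar> * (q - p)" using pq by simp
  moreover have "cmod (h t) \<le> B / \<bar>k\<bar>" if "t \<in> {p..q}" for t
    using B that by (auto simp: h_def norm_mult norm_divide intro!: divide_right_mono)
  then have "cmod (h q) \<le> B / \<bar>k\<bar>" "cmod (h p) \<le> B / \<bar>k\<bar>" using pq by auto
  moreover have "cmod J \<le> cmod (h q - h p - J) + cmod (h q) + cmod (h p)"
  proof -
    have "J = h q - h p - (h q - h p - J)" by simp
    then have "cmod J \<le> cmod (h q - h p) + cmod (h q - h p - J)" by (metis norm_triangle_ineq4)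
    then show ?thesis using norm_triangle_ineq4[of "h q" "h p"] by linarith
  qed
  ultimately have "cmod J \<le> B / \<bar>k\<bar> * (q - p) + B / \<bar>k\<bar> + B / \<bar>k\<bar>" by linarith
  also have "\<dots> = B * (2 + (q - p)) / \<bar>k\<bar>"
    by (simp add: add_divide_distrib[symmetric]) (simp add: algebra_simps)
  finally show ?thesis by (simp add: J_def)
qed

lemma integral_cis_mult_tendsto_0:
  fixes g g' :: "nat \<Rightarrow> real \<Rightarrow> complex"
  assumes pq: "p \<le> q"
    and k: "filterlim (\<lambda>n. \<bar>k n\<bar>) at_top sequentially"
    and g: "\<And>n t. t \<in> {p..q} \<Longrightarrow> (g n has_vector_derivative g' n t) (at t)"
    and B: "\<And>n t. t \<in> {p..q} \<Longrightarrow> cmod (g n t) \<le> B" "\<And>n t. t \<in> {p..q} \<Longrightarrow> cmod (g' n t) \<le> B"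
  shows "(\<lambda>n. integral {p..q} (\<lambda>t. cis (k n * t) * g n t)) \<longlonglongrightarrow> 0"
proof (rule Lim_null_comparison)
  have "\<forall>\<^sub>F n in sequentially. \<bar>k n\<bar> > 0"
    using k unfolding filterlim_at_top_dense by blast
  then show "\<forall>\<^sub>F n in sequentially. norm (integral {p..q} (\<lambda>t. cis (k n * t) * g n t)) \<le> B * (2 + (q - p)) / \<bar>k n\<bar>"
    by eventually_elim (rule integral_cis_mult_bound[OF _ pq g B], auto)
  show "(\<lambda>n. B * (2 + (q - p)) / \<bar>k n\<bar>) \<longlonglongrightarrow> 0"
    by (rule tendsto_divide_0[OF tendsto_const filterlim_at_top_imp_at_infinity[OF k]])
qed

section \<open>Generating series in the vertical direction\<close>

definition row_series :: "(int \<Rightarrow> int \<Rightarrow> complex) \<Rightarrow> int \<Rightarrow> complex \<Rightarrow> complex" where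
  "row_series F m x = (\<Sum>n. F m (int n) * x ^ n)"

definition row_series_deriv :: "(int \<Rightarrow> int \<Rightarrow> complex) \<Rightarrow> int \<Rightarrow> complex \<Rightarrow> complex" where
  "row_series_deriv F m x = (\<Sum>n. diffs (\<lambda>n. F m (int n)) n * x ^ n)"

context
  fixes F :: "int \<Rightarrow> int \<Rightarrow> complex" and c K :: real
  assumes entire: "discrete_entire F"
    and K: "K \<ge> 1"
    and growth: "\<And>m n. cmod (F m n) \<le> c * K powi \<bar>n\<bar>"
begin

lemma growth_nonneg_rows: "cmod (F m (int n)) \<le> c * K ^ n"
  using growth[of m "int n"] by (simp add: power_int_def)

lemma growth_constant_nonneg: "c \<ge> 0"
  using order_trans[OF norm_ge_zero growth[of 0 0]] by simp

lemma row_series_summable: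
  assumes "K * cmod x < 1"
  shows "summable (\<lambda>n. F m (int n) * x ^ n)"
proof (rule summable_comparison_test'[where N=0])
  show "summable (\<lambda>n. c * (K * cmod x) ^ n)"
    using assms K by (intro summable_mult summable_geometric) simp
  show "norm (F m (int n) * x ^ n) \<le> c * (K * cmod x) ^ n" for n
  proof -
    have "norm (F m (int n) * x ^ n) \<le> c * K ^ n * cmod x ^ n"
      unfolding norm_mult norm_power by (intro mult_right_mono growth_nonneg_rows) simp
    then show ?thesis by (simp add: power_mult_distrib mult_ac)
  qed
qed

lemma row_series_has_field_derivative:
  assumes "K * cmod x < 1"
  shows "(row_series F m has_field_derivative row_series_deriv F m x) (at x)"
  unfolding row_series_def [abs_def] row_series_deriv_def
proof (rule termdiffs_strong'[where K="1 / K"])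
  show "summable (\<lambda>n. F m (int n) * z ^ n)" if "norm z < 1 / K" for z
    using that K by (intro row_series_summable) (simp add: field_simps)
  show "norm x < 1 / K" using assms K by (simp add: field_simps)
qed

text \<open>
  The bound \<open>B\<close> is uniform in \<open>m\<close>, since the coefficients are dominated by \<open>c K\<^sup>n\<close> independently
  of \<open>m\<close>. The derivative is compared with the term-by-term derivative of the dominating geometric series.
\<close>

lemma row_series_bounded:
  assumes \<rho>: "\<rho> < 1"
  shows "\<exists>B. \<forall>m x. K * cmod x \<le> \<rho> \<longrightarrow> cmod (row_series F m x) \<le> B \<and> cmod (row_series_deriv F m x) \<le> B"
proof (cases "\<rho> \<ge> 0")
  case True
  \<comment> \<open>The largest \<open>\<bar>x\<bar>\<close> allowed, strictly inside the disc of convergence of \<open>(\<Sum>n. c K\<^sup>n x\<^sup>n)\<close>.\<close>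
  define r where "r = \<rho> / K"
  have r: "0 \<le> r" "r < 1 / K" using K \<rho> True by (auto simp: r_def field_simps)
  define a where "a = (\<lambda>n. c * K ^ n)"
  have sa: "summable (\<lambda>n. a n * z ^ n)" if "norm z < 1 / K" for z :: real
  proof -
    have "\<bar>K * z\<bar> < 1" using that K by (simp add: abs_mult field_simps)
    then have "summable (\<lambda>n. c * (K * z) ^ n)" by (intro summable_mult summable_geometric) simp
    then show ?thesis by (simp add: a_def power_mult_distrib mult_ac)
  qed
  have s0: "summable (\<lambda>n. a n * r ^ n)" using r by (intro sa) simp
  have s1: "summable (\<lambda>n. diffs a n * r ^ n)"
    using r by (intro termdiff_converges[where K="1 / K"] sa) auto
  have "cmod (row_series F m x) \<le> (\<Sum>n. a n * r ^ n) \<and> cmod (row_series_deriv F m x) \<le> (\<Sum>n. diffs a n * r ^ n)"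
    if "K * cmod x \<le> \<rho>" for m x
  proof
    have x: "cmod x \<le> r" using that K by (simp add: r_def field_simps)
    show "cmod (row_series F m x) \<le> (\<Sum>n. a n * r ^ n)"
      unfolding row_series_def
    proof (rule norm_suminf_le[OF _ s0])
      show "norm (F m (int n) * x ^ n) \<le> a n * r ^ n" for n
        unfolding norm_mult norm_power a_def using growth_constant_nonneg K
        by (intro mult_mono growth_nonneg_rows power_mono x) auto
    qed
    show "cmod (row_series_deriv F m x) \<le> (\<Sum>n. diffs a n * r ^ n)"
      unfolding row_series_deriv_def
    proof (rule norm_suminf_le[OF _ s1])
      show "norm (diffs (\<lambda>n. F m (int n)) n * x ^ n) \<le> diffs a n * r ^ n" for n
        unfolding norm_mult norm_power diffs_def norm_of_nat a_def using growth_constant_nonneg K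
        by (intro mult_mono growth_nonneg_rows power_mono x order_refl) auto
    qed
  qed
  then show ?thesis by (meson max.cobounded1 max.cobounded2 order_trans)
next
  case False
  have "\<not> K * cmod x \<le> \<rho>" for x
  proof -
    have "0 \<le> K * cmod x" using K by (intro mult_nonneg_nonneg) auto
    then show ?thesis using False by linarith
  qed
  then show ?thesis by blast
qed

text \<open>
  Multiplying the equation of entire functions at \<open>(m, n)\<close> by \<open>x\<^sup>n\<^sup>+\<^sup>1\<close> and summing over \<open>n \<ge> 0\<close>; the
  right-hand side collects the terms of the row \<open>0\<close> that the index shift leaves over.
\<close>

lemma row_series_recurrence:
  assumes x: "K * cmod x < 1"
  shows "(1 - \<i> * x) * row_series F (m + 1) x + (\<i> - x) * row_series F m x = F (m + 1) 0 + \<i> * F m 0"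
proof -
  note s = row_series_summable[OF x]
  define T where "T = (\<lambda>m. \<Sum>n. F m (int (Suc n)) * x ^ n)"
  have sT: "summable (\<lambda>n. F m (int (Suc n)) * x ^ n)" for m
    using powser_split_head(3)[OF s] by blast
  have P: "row_series F m x = F m 0 + T m * x" for m
    using powser_split_head(1)[OF s] by (simp add: row_series_def T_def)
  have "F (m + 1) (int (Suc n)) + \<i> * F m (int (Suc n)) = F m (int n) + \<i> * F (m + 1) (int n)" for n
    using entire[unfolded discrete_entire_def, rule_format, of m "int n"] by (simp add: algebra_simps)
  then have "(\<lambda>n. F (m + 1) (int (Suc n)) * x ^ n + \<i> * (F m (int (Suc n)) * x ^ n))
      = (\<lambda>n. F m (int n) * x ^ n + \<i> * (F (m + 1) (int n) * x ^ n))"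
    by (metis (no_types, lifting) distrib_right mult.assoc)
  then have "T (m + 1) + \<i> * T m = row_series F m x + \<i> * row_series F (m + 1) x"
    unfolding T_def row_series_def
    by (simp only: suminf_add[OF sT summable_mult[OF sT]] suminf_add[OF s summable_mult[OF s]]
        suminf_mult[OF sT, symmetric] suminf_mult[OF s, symmetric])
  then have "(T (m + 1) + \<i> * T m) * x = (row_series F m x + \<i> * row_series F (m + 1) x) * x" by simp
  moreover have "T k * x = row_series F k x - F k 0" for k
    by (simp add: P)
  ultimately have "(row_series F (m + 1) x - F (m + 1) 0) + \<i> * (row_series F m x - F m 0)
      = (row_series F m x + \<i> * row_series F (m + 1) x) * x"
    by (simp only: distrib_right[of "T (m + 1)"] mult.assoc[of "\<i>" "T m"])
  then show ?thesis by algebra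
qed

end

section \<open>Vanishing of the density outside the set D\<close>

text \<open>
  Multiplied by \<open>cis (- (m + 1) t)\<close>, the recurrence says that \<open>a (m + 1) + \<i> a m\<close> contributes a
  difference of consecutive values of \<open>torus_char (- m) t * r m\<close>. The last two terms correct for the index shift at the
  two ends of the partial sum.
\<close>

lemma symmetric_partial_sum_telescope:
  fixes a r :: "int \<Rightarrow> complex"
  assumes rec: "\<And>m. r (m + 1) = a (m + 1) + \<i> * a m + cis t * r m"
  shows "(1 + \<i> * cis (- t)) * symmetric_partial_sum a n t =
    torus_char (- int n) t * r (int n) - torus_char (int n) t * r (- int n)
    + \<i> * a (int n) * torus_char (- int n - 1) t + a (- int n) * torus_char (int n) t"
proof (induction n)
  case 0
  then show ?case by (simp add: trig_sum_def torus_char_def algebra_simps)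
next
  case (Suc n)
  define u v e f where "u = cis t" and "v = cis (- t)" and "e = torus_char (int n) t" and "f = torus_char (- int n) t"
  have uv: "u * v = 1" by (simp add: u_def v_def cis_mult)
  have ch: "torus_char (- int n - 1) t = f * v" "torus_char (int (Suc n)) t = e * u"
    "torus_char (- int (Suc n)) t = f * v" "torus_char (- int (Suc n) - 1) t = f * v * v"
    unfolding torus_char_def e_def f_def u_def v_def cis_mult
    by (rule arg_cong[where f=cis], simp add: algebra_simps)+
  have "{- int (Suc n)..int (Suc n)} = insert (int (Suc n)) (insert (- int (Suc n)) {- int n..int n})"
    by auto
  then have "symmetric_partial_sum a (Suc n) t = a (int (Suc n)) * torus_char (- int (Suc n)) t
      + (a (- int (Suc n)) * torus_char (- (- int (Suc n))) t + symmetric_partial_sum a n t)"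
    by (simp add: trig_sum_def)
  then have S: "symmetric_partial_sum a (Suc n) t = a (int (Suc n)) * (f * v) + (a (- int (Suc n)) * (e * u) + symmetric_partial_sum a n t)"
    unfolding minus_minus ch .
  have r1: "r (int (Suc n)) = a (int (Suc n)) + \<i> * a (int n) + u * r (int n)"
    using rec[of "int n"] by (simp add: u_def add.commute)
  have r2: "r (- int n) = a (- int n) + \<i> * a (- int (Suc n)) + u * r (- int (Suc n))"
    using rec[of "- int (Suc n)"] by (simp add: u_def)
  have IH: "(1 + \<i> * v) * symmetric_partial_sum a n t =
    f * r (int n) - e * r (- int n) + \<i> * a (int n) * (f * v) + a (- int n) * e"
    using Suc.IH by (simp add: ch v_def e_def f_def)
  have "(1 + \<i> * v) * symmetric_partial_sum a (Suc n) t = f * v * r (int (Suc n)) - e * u * r (- int (Suc n))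
    + \<i> * a (int (Suc n)) * (f * v * v) + a (- int (Suc n)) * (e * u)"
    unfolding S distrib_left IH r1 r2 using uv by algebra
  then show ?case unfolding ch v_def .
qed

text \<open>
  On the unit circle this is \<open>1 / discrete_exp t 0 1\<close>, written as a function of \<open>w = cis t\<close> so that it
  can be differentiated in the complex sense. It has its zero, at \<open>w = -\<i>\<close>, inside the arc
  \<open>(-pi + \<alpha>, -\<alpha>)\<close>, which is why that arc is treated with series in nonnegative powers.
\<close>

definition inverse_factor :: "complex \<Rightarrow> complex" where
  "inverse_factor w = (\<i> + w) / (1 + \<i> * w)"

lemma inverse_factor_cis: "inverse_factor (cis t) = inverse (discrete_exp t 0 1)"
  by (simp add: inverse_factor_def discrete_exp_0_1 divide_inverse mult.commute)

lemma inverse_factor_has_field_derivative: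
  assumes "1 + \<i> * w \<noteq> 0"
  shows "(inverse_factor has_field_derivative 2 / (1 + \<i> * w)\<^sup>2) (at w)"
  unfolding inverse_factor_def [abs_def]
  using assms by (auto intro!: derivative_eq_intros simp: power2_eq_square algebra_simps)

context
  fixes \<alpha> :: real
  assumes \<alpha>: "0 < \<alpha>" "\<alpha> < pi / 2"
begin

lemma sin_lower_arc:
  assumes "-pi + \<alpha> < t" "t < -\<alpha>"
  shows "sin t < - sin \<alpha>"
proof -
  have "sin \<alpha> < sin (- t)"
  proof (cases "- t \<le> pi / 2")
    case True
    then show ?thesis using assms \<alpha> by (intro sin_monotone_2pi) auto
  next
    case False
    have "sin \<alpha> < sin (pi - (- t))" using assms \<alpha> False by (intro sin_monotone_2pi) auto
    then show ?thesis by simp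
  qed
  then show ?thesis by simp
qed

lemma denominator_lower_arc:
  assumes "-pi + \<alpha> < t" "t < -\<alpha>"
  shows "cmod (1 + \<i> * cis t) \<ge> 1" "1 + \<i> * cis t \<noteq> 0"
proof -
  have "sin t < 0" using sin_lower_arc[OF assms] sin_between_0_and_1[OF \<alpha>] by linarith
  then have "1\<^sup>2 \<le> (cmod (1 + \<i> * cis t))\<^sup>2" unfolding norm_1_plus_i_cis by simp
  then show "cmod (1 + \<i> * cis t) \<ge> 1" by (rule power2_le_imp_le) simp
  then show "1 + \<i> * cis t \<noteq> 0" by auto
qed

lemma inverse_factor_lower_arc:
  assumes t: "-pi + \<alpha> < t" "t < -\<alpha>"
  shows "growth_rate \<alpha> * cmod (inverse_factor (cis t)) < 1"
proof -
  have s: "sin t < - sin \<alpha>" by (rule sin_lower_arc[OF t])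
  note a = sin_between_0_and_1[OF \<alpha>]
  have "(growth_rate \<alpha> * cmod (inverse_factor (cis t)))\<^sup>2 = (1 + sin \<alpha>) / (1 - sin \<alpha>) * ((1 + sin t) / (1 - sin t))"
    unfolding power_mult_distrib growth_rate_square[OF \<alpha>] inverse_factor_cis norm_inverse power_inverse norm_discrete_exp_0_1
    by simp
  also have "\<dots> < 1\<^sup>2"
  proof -
    have "(1 + sin \<alpha>) * (1 + sin t) < (1 - sin \<alpha>) * (1 - sin t)"
      using s a by (simp add: algebra_simps)
    moreover have "0 < (1 - sin \<alpha>) * (1 - sin t)" using s a by (intro mult_pos_pos) auto
    ultimately show ?thesis by simp
  qed
  finally show ?thesis by (rule power2_less_imp_less) simp
qed

lemma inverse_factor_lower_arc_uniform:
  assumes pq: "-pi + \<alpha> < p" "p < q" "q < -\<alpha>"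
  shows "\<exists>\<rho><1. \<forall>t\<in>{p..q}. growth_rate \<alpha> * cmod (inverse_factor (cis t)) \<le> \<rho>"
proof -
  have "continuous_on {p..q} (\<lambda>t. growth_rate \<alpha> * cmod (inverse_factor (cis t)))"
    unfolding inverse_factor_def using pq denominator_lower_arc(2) by (intro continuous_intros) auto
  then obtain t0 where "t0 \<in> {p..q}"
      "\<forall>t\<in>{p..q}. growth_rate \<alpha> * cmod (inverse_factor (cis t)) \<le> growth_rate \<alpha> * cmod (inverse_factor (cis t0))"
    using continuous_attains_sup[of "{p..q}" "\<lambda>t. growth_rate \<alpha> * cmod (inverse_factor (cis t))"] pq by auto
  then show ?thesis using inverse_factor_lower_arc[of t0] pq by auto
qed

context
  fixes F :: "int \<Rightarrow> int \<Rightarrow> complex" and c :: real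
  assumes entire: "discrete_entire F"
    and growth: "\<And>m n. cmod (F m n) \<le> c * growth_rate \<alpha> powi \<bar>n\<bar>"
begin

lemma row_0_bounded: "cmod (F m 0) \<le> c"
  using growth[of m 0] by simp

text \<open>
  The solution of the telescoping recurrence: with \<open>x = inverse_factor w\<close> one has
  \<open>x - \<i> = w (1 - \<i> x)\<close>, so the factor \<open>1 - \<i> x\<close> normalises \<open>row_series_recurrence\<close>.
\<close>

definition arc_series :: "int \<Rightarrow> complex \<Rightarrow> complex" where
  "arc_series m w = (1 - \<i> * inverse_factor w) * row_series F m (inverse_factor w)"

definition arc_series_deriv :: "int \<Rightarrow> complex \<Rightarrow> complex" where
  "arc_series_deriv m w = (2 / (1 + \<i> * w)\<^sup>2) *
     ((1 - \<i> * inverse_factor w) * row_series_deriv F m (inverse_factor w) - \<i> * row_series F m (inverse_factor w))"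

lemma arc_series_recurrence:
  assumes t: "-pi + \<alpha> < t" "t < -\<alpha>"
  shows "arc_series (m + 1) (cis t) = F (m + 1) 0 + \<i> * F m 0 + cis t * arc_series m (cis t)"
proof -
  define w x where "w = cis t" and "x = inverse_factor w"
  have nz: "1 + \<i> * w \<noteq> 0" using denominator_lower_arc[OF t] by (simp add: w_def)
  have "(1 - \<i> * x) * row_series F (m + 1) x + (\<i> - x) * row_series F m x = F (m + 1) 0 + \<i> * F m 0"
    using inverse_factor_lower_arc[OF t] unfolding x_def w_def
    by (rule row_series_recurrence[OF entire growth_rate_ge_1[OF \<alpha>] growth])
  moreover have "x * (1 + \<i> * w) = \<i> + w"
    using nz by (simp add: x_def inverse_factor_def)
  then have "\<i> - x = - (w * (1 - \<i> * x))" by (simp add: algebra_simps) 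
  ultimately show ?thesis unfolding arc_series_def w_def[symmetric] x_def[symmetric]
    by (simp add: algebra_simps)
qed

lemma arc_series_has_vector_derivative:
  assumes t: "-pi + \<alpha> < t" "t < -\<alpha>"
  shows "((\<lambda>t. arc_series m (cis t)) has_vector_derivative \<i> * cis t * arc_series_deriv m (cis t)) (at t)"
proof -
  define w where "w = cis t"
  have nz: "1 + \<i> * w \<noteq> 0" using denominator_lower_arc[OF t] by (simp add: w_def)
  define d where "d = 2 / (1 + \<i> * w)\<^sup>2"
  have X: "(inverse_factor has_field_derivative d) (at w)"
    unfolding d_def by (rule inverse_factor_has_field_derivative[OF nz])
  have P: "(row_series F m has_field_derivative row_series_deriv F m (inverse_factor w)) (at (inverse_factor w))"
    using inverse_factor_lower_arc[OF t] unfolding w_def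
    by (rule row_series_has_field_derivative[OF entire growth_rate_ge_1[OF \<alpha>] growth])
  have "(arc_series m has_field_derivative arc_series_deriv m w) (at w)"
    unfolding arc_series_def [abs_def] arc_series_deriv_def d_def[symmetric]
    by (rule derivative_eq_intros DERIV_chain2[OF P X] X refl)+ (simp add: algebra_simps)
  moreover have "(cis has_vector_derivative \<i> * w) (at t)"
    unfolding cis_conv_exp [abs_def] w_def
    by (auto intro!: derivative_eq_intros has_vector_derivative_real_field)
  ultimately show ?thesis
    using field_vector_diff_chain_at[of cis "\<i> * w" t "arc_series m"] by (simp add: w_def o_def)
qed

text \<open>
  On a compact subinterval \<open>K \<bar>x\<bar>\<close> stays below some \<open>\<rho> < 1\<close>. Moreover \<open>\<bar>x\<bar> \<le> 1\<close> and
  \<open>\<bar>1 + \<i> w\<bar> \<ge> 1\<close> there, which bounds \<open>1 - \<i> x\<close> and the derivative of \<open>inverse_factor\<close> by \<open>2\<close>.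
\<close>

lemma arc_series_bounded:
  assumes pq: "-pi + \<alpha> < p" "p < q" "q < -\<alpha>"
  shows "\<exists>B. \<forall>m. \<forall>t\<in>{p..q}. cmod (arc_series m (cis t)) \<le> B \<and> cmod (\<i> * cis t * arc_series_deriv m (cis t)) \<le> B"
proof -
  obtain \<rho> where \<rho>: "\<rho> < 1" "\<And>t. t \<in> {p..q} \<Longrightarrow> growth_rate \<alpha> * cmod (inverse_factor (cis t)) \<le> \<rho>"
    using inverse_factor_lower_arc_uniform[OF pq] by blast
  obtain B where B: "\<And>m x. growth_rate \<alpha> * cmod x \<le> \<rho> \<Longrightarrow> cmod (row_series F m x) \<le> B \<and> cmod (row_series_deriv F m x) \<le> B"
    using row_series_bounded[OF entire growth_rate_ge_1[OF \<alpha>] growth \<rho>(1)] by blast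
  have "cmod (arc_series m (cis t)) \<le> 6 * B \<and> cmod (\<i> * cis t * arc_series_deriv m (cis t)) \<le> 6 * B"
    if t: "t \<in> {p..q}" for m t
  proof -
    define x where "x = inverse_factor (cis t)"
    have tt: "-pi + \<alpha> < t" "t < -\<alpha>" using t pq by auto
    have b: "cmod (row_series F m x) \<le> B" "cmod (row_series_deriv F m x) \<le> B"
      using B[OF \<rho>(2)[OF t]] by (auto simp: x_def)
    have B0: "B \<ge> 0" using b(1) norm_ge_zero[of "row_series F m x"] by linarith
    have "1 * cmod x \<le> growth_rate \<alpha> * cmod x"
      using growth_rate_ge_1[OF \<alpha>] by (intro mult_right_mono) auto
    then have "cmod x \<le> 1" using inverse_factor_lower_arc[OF tt] by (simp add: x_def)
    then have f: "cmod (1 - \<i> * x) \<le> 2"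
      using norm_triangle_ineq4[of 1 "\<i> * x"] by (simp add: norm_mult)
    have d: "cmod (2 / (1 + \<i> * cis t)\<^sup>2) \<le> 2"
      using denominator_lower_arc[OF tt] by (simp add: norm_divide norm_power field_simps)
    have "cmod (arc_series m (cis t)) \<le> 2 * B"
      unfolding arc_series_def x_def[symmetric] norm_mult by (intro mult_mono f b) auto
    moreover have "cmod (\<i> * cis t * arc_series_deriv m (cis t)) \<le> 2 * (2 * B + B)"
    proof -
      have "cmod ((1 - \<i> * x) * row_series_deriv F m x - \<i> * row_series F m x)
          \<le> cmod ((1 - \<i> * x) * row_series_deriv F m x) + cmod (\<i> * row_series F m x)"
        by (rule norm_triangle_ineq4)
      also have "\<dots> \<le> 2 * B + B"
        unfolding norm_mult using f b by (intro add_mono mult_mono) auto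
      finally have "cmod ((1 - \<i> * x) * row_series_deriv F m x - \<i> * row_series F m x) \<le> 2 * B + B" .
      then have "cmod (arc_series_deriv m (cis t)) \<le> 2 * (2 * B + B)"
        unfolding arc_series_deriv_def x_def[symmetric] norm_mult[of "2 / _"] using d by (intro mult_mono) auto
      then show ?thesis by (simp add: norm_mult)
    qed
    ultimately show ?thesis using B0 by auto
  qed
  then show ?thesis by blast
qed

text \<open>
  After telescoping, the integrand consists of four terms, each an oscillation of frequency about \<open>n\<close>
  times an amplitude from a family that is bounded together with its derivative.
\<close>

lemma integral_partial_sums_tendsto_0:
  assumes pq: "-pi + \<alpha> < p" "p < q" "q < -\<alpha>"
  shows "(\<lambda>n. integral {p..q} (\<lambda>t. (1 + \<i> * cis (- t)) * symmetric_partial_sum (\<lambda>m. F m 0) n t)) \<longlonglongrightarrow> 0"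
proof -
  obtain B where B: "\<And>m t. t \<in> {p..q} \<Longrightarrow> cmod (arc_series m (cis t)) \<le> B"
      "\<And>m t. t \<in> {p..q} \<Longrightarrow> cmod (\<i> * cis t * arc_series_deriv m (cis t)) \<le> B"
    using arc_series_bounded[OF pq] by blast
  have der: "((\<lambda>t. arc_series m (cis t)) has_vector_derivative \<i> * cis t * arc_series_deriv m (cis t)) (at t)"
    if "t \<in> {p..q}" for m t
    using that pq by (intro arc_series_has_vector_derivative) auto
  define I where "I = (\<lambda>k g. integral {p..q} (\<lambda>t. cis (k * t) * g t))"
  have c0: "0 \<le> c" using row_0_bounded[of 0] norm_ge_zero[of "F 0 0"] by linarith
  have at: "filterlim (\<lambda>n. \<bar>- real n\<bar>) at_top sequentially" "filterlim (\<lambda>n. \<bar>real n\<bar>) at_top sequentially"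
    using filterlim_real_sequentially by simp_all
  have at1: "filterlim (\<lambda>n. \<bar>- real n - 1\<bar>) at_top sequentially"
  proof -
    have "\<bar>- real n - 1\<bar> = real (Suc n)" for n by simp
    then show ?thesis
      using filterlim_compose[OF filterlim_real_sequentially filterlim_Suc] by simp
  qed
  have lim1: "(\<lambda>n. I (- real n) (\<lambda>t. arc_series (int n) (cis t))) \<longlonglongrightarrow> 0"
    unfolding I_def using pq der B by (intro integral_cis_mult_tendsto_0[OF _ at(1)]) auto
  have lim2: "(\<lambda>n. I (real n) (\<lambda>t. arc_series (- int n) (cis t))) \<longlonglongrightarrow> 0"
    unfolding I_def using pq der B by (intro integral_cis_mult_tendsto_0[OF _ at(2)]) auto
  have lim3: "(\<lambda>n. I (- real n - 1) (\<lambda>t. \<i> * F (int n) 0)) \<longlonglongrightarrow> 0"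
    unfolding I_def using pq row_0_bounded c0
    by (intro integral_cis_mult_tendsto_0[OF _ at1, where B=c and g'="\<lambda>_ _. 0"]) (auto simp: norm_mult)
  have lim4: "(\<lambda>n. I (real n) (\<lambda>t. F (- int n) 0)) \<longlonglongrightarrow> 0"
    unfolding I_def using pq row_0_bounded c0
    by (intro integral_cis_mult_tendsto_0[OF _ at(2), where B=c and g'="\<lambda>_ _. 0"]) auto
  have "integral {p..q} (\<lambda>t. (1 + \<i> * cis (- t)) * symmetric_partial_sum (\<lambda>m. F m 0) n t) =
      I (- real n) (\<lambda>t. arc_series (int n) (cis t)) - I (real n) (\<lambda>t. arc_series (- int n) (cis t))
      + I (- real n - 1) (\<lambda>t. \<i> * F (int n) 0) + I (real n) (\<lambda>t. F (- int n) 0)" for n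
  proof -
    have ca: "continuous_on {p..q} (\<lambda>t. arc_series m (cis t))" for m
      by (intro continuous_at_imp_continuous_on ballI) (rule has_vector_derivative_continuous[OF der])
    have "integral {p..q} (\<lambda>t. (1 + \<i> * cis (- t)) * symmetric_partial_sum (\<lambda>m. F m 0) n t) =
      integral {p..q} (\<lambda>t. cis (- real n * t) * arc_series (int n) (cis t) - cis (real n * t) * arc_series (- int n) (cis t)
      + cis ((- real n - 1) * t) * (\<i> * F (int n) 0) + cis (real n * t) * F (- int n) 0)"
    proof (rule Henstock_Kurzweil_Integration.integral_cong)
      fix t assume "t \<in> {p..q}"
      then have t: "-pi + \<alpha> < t" "t < -\<alpha>" using pq by auto
      from symmetric_partial_sum_telescope[where a="\<lambda>m. F m 0" and r="\<lambda>m. arc_series m (cis t)", OF arc_series_recurrence[OF t], of n]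
      show "(1 + \<i> * cis (- t)) * symmetric_partial_sum (\<lambda>m. F m 0) n t =
        cis (- real n * t) * arc_series (int n) (cis t) - cis (real n * t) * arc_series (- int n) (cis t)
        + cis ((- real n - 1) * t) * (\<i> * F (int n) 0) + cis (real n * t) * F (- int n) 0"
        by (simp add: torus_char_def mult.commute[of _ "cis _"])
    qed
    also have "\<dots> = I (- real n) (\<lambda>t. arc_series (int n) (cis t)) - I (real n) (\<lambda>t. arc_series (- int n) (cis t))
      + I (- real n - 1) (\<lambda>t. \<i> * F (int n) 0) + I (real n) (\<lambda>t. F (- int n) 0)"
      unfolding I_def
      by (subst Henstock_Kurzweil_Integration.integral_add Henstock_Kurzweil_Integration.integral_diff,
          (intro integrable_continuous_interval continuous_intros ca)+)+ simp
    finally show ?thesis .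
  qed
  then show ?thesis
    using tendsto_add[OF tendsto_add[OF tendsto_diff[OF lim1 lim2] lim3] lim4] by simp
qed

end
end

text \<open>
  \<open>L\<^sup>2\<close> convergence of the partial sums on a bounded interval implies weak convergence against
  bounded continuous functions.
\<close>

lemma integral_partial_sums_tendsto:
  assumes f: "f \<in> L2_torus" and pq: "-pi \<le> p" "q < pi"
    and g: "continuous_on UNIV g" "\<And>t. cmod (g t) \<le> C"
  shows "(\<lambda>n. integral {p..q} (\<lambda>t. g t * symmetric_partial_sum (\<lambda>m. PW_transform f m 0) n t))
           \<longlonglongrightarrow> (LINT t:{p..q}|torus. g t * f t)"
proof (rule LIMSEQ_I)
  fix e :: real assume e: "e > 0"
  define S where "S = symmetric_partial_sum (\<lambda>m. PW_transform f m 0)"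
  have S: "S n \<in> L2_torus" for n by (simp add: S_def trig_sum_L2)
  have C: "C \<ge> 0" using g(2)[of 0] norm_ge_zero[of "g 0"] by linarith
  obtain d where d: "d > 0" "\<And>h. h \<in> L2_torus \<Longrightarrow> (LINT t|torus. (cmod (h t))\<^sup>2) < d \<Longrightarrow> (LINT t|torus. cmod (h t)) < e / (C + 1)"
    using L1_small_if_L2_small[of "e / (C + 1)"] e C by auto
  have I: "{p..q} \<in> sets torus" using pq by (auto simp: torus_def sets_restrict_space_iff)
  have int: "set_integrable torus {p..q} (\<lambda>t. g t * h t)" if h: "h \<in> L2_torus" for h
  proof -
    have "integrable torus (\<lambda>t. h t * g t)"
      by (rule integrable_torus_bounded_mult[OF L2_torus_integrable[OF h] measurable_torus_continuous[OF g(1)], of C]) (simp add: g)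
    then show ?thesis
      unfolding set_integrable_def by (intro integrable_mult_indicator I) (simp add: mult.commute)
  qed
  have bound: "norm (integral {p..q} (\<lambda>t. g t * S n t) - (LINT t:{p..q}|torus. g t * f t)) \<le> C * (LINT t|torus. cmod (f t - S n t))" for n
  proof -
    have df: "(\<lambda>t. f t - S n t) \<in> L2_torus" by (rule L2_torus_diff[OF f S])
    have "integral {p..q} (\<lambda>t. g t * S n t) = (LINT t:{p..q}|torus. g t * S n t)"
      using pq by (intro torus_set_integral[symmetric] continuous_intros continuous_on_subset[OF g(1)])
        (auto simp: S_def continuous_trig_sum)
    then have "integral {p..q} (\<lambda>t. g t * S n t) - (LINT t:{p..q}|torus. g t * f t) = - (LINT t:{p..q}|torus. g t * f t - g t * S n t)"
      using set_integral_diff(2)[OF int[OF f] int[OF S]] by simp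
    then have "norm (integral {p..q} (\<lambda>t. g t * S n t) - (LINT t:{p..q}|torus. g t * f t))
        = norm (LINT t|torus. indicator {p..q} t *\<^sub>R (g t * (f t - S n t)))"
      by (simp add: set_lebesgue_integral_def right_diff_distrib)
    also have "\<dots> \<le> (LINT t|torus. norm (indicator {p..q} t *\<^sub>R (g t * (f t - S n t))))"
      by (rule integral_norm_bound)
    also have "\<dots> \<le> (LINT t|torus. C * cmod (f t - S n t))"
    proof (rule integral_mono)
      show "integrable torus (\<lambda>t. norm (indicator {p..q} t *\<^sub>R (g t * (f t - S n t))))"
        using int[OF df] unfolding set_integrable_def by (rule integrable_norm)
      show "integrable torus (\<lambda>t. C * cmod (f t - S n t))"
        using L2_torus_integrable[OF df] by (intro integrable_mult_right integrable_norm)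
      show "norm (indicator {p..q} t *\<^sub>R (g t * (f t - S n t))) \<le> C * cmod (f t - S n t)" for t
        using g(2)[of t] C by (auto simp: indicator_def norm_mult intro!: mult_right_mono)
    qed
    finally show ?thesis by simp
  qed
  have "\<forall>\<^sub>F n in sequentially. (LINT t|torus. (cmod (f t - S n t))\<^sup>2) < d"
    using Parseval(3)[OF f] d(1) unfolding S_def by (rule order_tendstoD)
  then obtain N where N: "\<And>n. n \<ge> N \<Longrightarrow> (LINT t|torus. (cmod (f t - S n t))\<^sup>2) < d"
    unfolding eventually_sequentially by blast
  have "norm (integral {p..q} (\<lambda>t. g t * S n t) - (LINT t:{p..q}|torus. g t * f t)) < e" if "n \<ge> N" for n
  proof -
    have "C * (LINT t|torus. cmod (f t - S n t)) \<le> C * (e / (C + 1))"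
      using d(2)[OF L2_torus_diff[OF f S] N[OF that]] C by (intro mult_left_mono) auto
    also have "\<dots> < e" using e C by (simp add: field_simps)
    finally show ?thesis using bound[of n] by linarith
  qed
  then show "\<exists>N. \<forall>n\<ge>N. norm (integral {p..q} (\<lambda>t. g t * symmetric_partial_sum (\<lambda>m. PW_transform f m 0) n t) - (LINT t:{p..q}|torus. g t * f t)) < e"
    unfolding S_def by blast
qed

lemma AE_zero_if_partial_sums_tendsto_0:
  assumes f: "f \<in> L2_torus" and uv: "-pi \<le> u" "v \<le> pi"
    and g: "continuous_on UNIV g" "\<And>t. cmod (g t) \<le> C"
    and lim: "\<And>p q. u < p \<Longrightarrow> p < q \<Longrightarrow> q < v \<Longrightarrow>
      (\<lambda>n. integral {p..q} (\<lambda>t. g t * symmetric_partial_sum (\<lambda>m. PW_transform f m 0) n t)) \<longlonglongrightarrow> 0"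
  shows "AE t in torus. u < t \<and> t < v \<longrightarrow> g t * f t = 0"
proof (rule torus_AE_zero_on_interval[OF _ uv])
  have "integrable torus (\<lambda>t. f t * g t)"
    by (rule integrable_torus_bounded_mult[OF L2_torus_integrable[OF f] measurable_torus_continuous[OF g(1)], of C]) (simp add: g)
  then show "integrable torus (\<lambda>t. g t * f t)" by (simp add: mult.commute)
  fix p q assume pq: "u < p" "p < q" "q < v"
  show "(LINT t:{p..q}|torus. g t * f t) = 0"
    by (rule LIMSEQ_unique[OF integral_partial_sums_tendsto[OF f _ _ g] lim[OF pq]]) (use pq uv in auto)
qed

lemma one_plus_i_cis_eq_0:
  assumes "0 < s" "s < pi" "1 + \<i> * cis s = 0"
  shows "s = pi / 2"
proof -
  have "Im (1 + \<i> * cis s) = 0" using assms(3) by (simp only: zero_complex.sel)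
  then have c: "cos s = cos (pi / 2)" by simp
  show ?thesis
    by (rule cos_inj_pi[OF _ _ _ _ c]) (use assms(1,2) in linarith)+
qed

lemma norm_one_plus_i_cis_le: "cmod (1 + \<i> * cis s) \<le> 2"
  using norm_triangle_ineq[of 1 "\<i> * cis s"] by (simp add: norm_mult)

lemma discrete_entire_reflect:
  assumes "discrete_entire F"
  shows "discrete_entire (\<lambda>m n. F (- m) (- n))"
  unfolding discrete_entire_def
proof (intro allI)
  fix m n
  have "F (- m) (- n) - F (- m - 1) (- n - 1) = - \<i> * (F (- m - 1) (- n) - F (- m) (- n - 1))"
    using assms[unfolded discrete_entire_def, rule_format, of "- m - 1" "- n - 1"] by simp
  then have "F (- m - 1) (- n - 1) - F (- m) (- n) = - \<i> * (F (- m) (- n - 1) - F (- m - 1) (- n))"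
    by algebra
  moreover have "- (m + 1) = - m - 1" "- (n + 1) = - n - 1" by simp_all
  ultimately show "F (- (m + 1)) (- (n + 1)) - F (- m) (- n) = - \<i> * (F (- m) (- (n + 1)) - F (- (m + 1)) (- n))"
    by (simp only:)
qed

lemma symmetric_partial_sum_reflect:
  "symmetric_partial_sum (\<lambda>m. a (- m)) n (- t) = symmetric_partial_sum a n t"
  unfolding trig_sum_def
  by (rule sum.reindex_bij_witness[where i=uminus and j=uminus]) (auto simp: torus_char_def)

context
  fixes \<alpha> :: real
  assumes \<alpha>: "0 < \<alpha>" "\<alpha> < pi / 2"
begin

text \<open>
  On the lower arc this combines the two limits of the integrals of the partial sums. The upper arc
  is the image of the lower one under \<open>t \<mapsto> -t\<close>, which replaces \<open>F m 0\<close> by \<open>F (- m) 0\<close> in the partial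
  sums. The multiplier vanishes only at the midpoint \<open>\<plusminus>pi/2\<close> of each arc.
\<close>

lemma supp_subset_D:
  assumes entire: "discrete_entire F"
    and growth: "\<And>m n. cmod (F m n) \<le> c * growth_rate \<alpha> powi \<bar>n\<bar>"
    and f: "f \<in> L2_torus" and coeff: "\<And>m. PW_transform f m 0 = F m 0"
  shows "supp_subset f (D \<alpha>)"
proof -
  have coeff': "(\<lambda>m. PW_transform f m 0) = (\<lambda>m. F m 0)" using coeff by auto
  have "AE t in torus. -pi + \<alpha> < t \<and> t < -\<alpha> \<longrightarrow> (1 + \<i> * cis (- t)) * f t = 0"
  proof (rule AE_zero_if_partial_sums_tendsto_0[OF f, where C=2])
    show "(\<lambda>n. integral {p..q} (\<lambda>t. (1 + \<i> * cis (- t)) * symmetric_partial_sum (\<lambda>m. PW_transform f m 0) n t)) \<longlonglongrightarrow> 0"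
      if "-pi + \<alpha> < p" "p < q" "q < -\<alpha>" for p q
      unfolding coeff' by (rule integral_partial_sums_tendsto_0[OF \<alpha> entire growth that])
  qed (use \<alpha> norm_one_plus_i_cis_le in \<open>auto intro!: continuous_intros\<close>)
  moreover have "AE t in torus. \<alpha> < t \<and> t < pi - \<alpha> \<longrightarrow> (1 + \<i> * cis t) * f t = 0"
  proof (rule AE_zero_if_partial_sums_tendsto_0[OF f, where C=2])
    fix p q assume pq: "\<alpha> < p" "p < q" "q < pi - \<alpha>"
    have "(\<lambda>n. integral {-q..-p} (\<lambda>t. (1 + \<i> * cis (- t)) * symmetric_partial_sum (\<lambda>m. F (- m) (- 0)) n t)) \<longlonglongrightarrow> 0"
      using growth[of "- m" "- n" for m n] pq
      by (intro integral_partial_sums_tendsto_0[OF \<alpha> discrete_entire_reflect[OF entire]]) auto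
    moreover have "integral {-q..-p} (\<lambda>t. (1 + \<i> * cis (- t)) * symmetric_partial_sum (\<lambda>m. F (- m) (- 0)) n t)
        = integral {p..q} (\<lambda>t. (1 + \<i> * cis t) * symmetric_partial_sum (\<lambda>m. F m 0) n t)" for n
      using Henstock_Kurzweil_Integration.integral_reflect_real[of q p "\<lambda>t. (1 + \<i> * cis t) * symmetric_partial_sum (\<lambda>m. F m 0) n t"]
        symmetric_partial_sum_reflect[of "\<lambda>m. F m 0" n "- t" for t] by simp
    ultimately show "(\<lambda>n. integral {p..q} (\<lambda>t. (1 + \<i> * cis t) * symmetric_partial_sum (\<lambda>m. PW_transform f m 0) n t)) \<longlonglongrightarrow> 0"
      unfolding coeff' by simp
  qed (use \<alpha> norm_one_plus_i_cis_le in \<open>auto intro!: continuous_intros\<close>)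
  moreover have "AE t in torus. t \<noteq> pi / 2" "AE t in torus. t \<noteq> - pi / 2" by (rule AE_torus_neq)+
  moreover have "AE t in torus. -pi \<le> t \<and> t < pi" by (rule AE_I2) simp
  ultimately show ?thesis
    unfolding supp_subset_def
  proof eventually_elim
    case (elim t)
    show ?case
    proof
      assume "t \<notin> D \<alpha>"
      then consider "-pi + \<alpha> < t" "t < -\<alpha>" | "\<alpha> < t" "t < pi - \<alpha>"
        using elim unfolding D_def by (cases "t \<ge> 0") auto
      then show "f t = 0"
      proof cases
        case 1
        then have "1 + \<i> * cis (- t) \<noteq> 0"
          using one_plus_i_cis_eq_0[of "- t"] elim \<alpha> by auto
        then show ?thesis using 1 elim by simp
      next
        case 2
        then have "1 + \<i> * cis t \<noteq> 0"
          using one_plus_i_cis_eq_0[of t] elim \<alpha> by auto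
        then show ?thesis using 2 elim by simp
      qed
    qed
  qed
qed

end

section \<open>Rows are determined by the row 0\<close>

text \<open>
  If the row \<open>n\<close> is zero, the row \<open>n + 1\<close> is a multiple of \<open>(-\<i>)\<^sup>m\<close>, and this solution of the homogeneous equation
  resonates in the row \<open>n + 2\<close>: after \<open>k\<close> steps to the right it has added \<open>2 \<i> k G m (n + 1)\<close>, up to a factor of
  modulus \<open>1\<close>. Boundedness of the row \<open>n + 2\<close> excludes this unless \<open>G m (n + 1) = 0\<close>.
\<close>

lemma entire_next_row_eq_0:
  assumes entire: "discrete_entire G"
    and bounded: "\<And>m. cmod (G m (n + 2)) \<le> B"
    and zero: "\<And>m. G m n = 0"
  shows "G m (n + 1) = 0"
proof -
  have rel: "G (k + 1) (j + 1) + \<i> * G k (j + 1) = G k j + \<i> * G (k + 1) j" for k j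
    using entire[unfolded discrete_entire_def, rule_format, of k j] by (simp add: algebra_simps)
  have step1: "G (k + 1) (n + 1) = - \<i> * G k (n + 1)" for k
    using rel[of k n] zero by (simp add: eq_neg_iff_add_eq_0)
  have step2: "G (k + 1) (n + 2) = - \<i> * G k (n + 2) + 2 * G k (n + 1)" for k
  proof -
    have "G (k + 1) (n + 2) + \<i> * G k (n + 2) = G k (n + 1) + \<i> * G (k + 1) (n + 1)"
      using rel[of k "n + 1"] by (simp add: add.assoc)
    also have "\<dots> = 2 * G k (n + 1)" unfolding step1[of k] by simp
    finally show ?thesis by (simp add: eq_diff_eq[symmetric])
  qed
  have row1: "\<i> ^ k * G (m + int k) (n + 1) = G m (n + 1)" for k
  proof (induction k)
    case (Suc k)
    have "\<i> ^ Suc k * G (m + int (Suc k)) (n + 1) = \<i> ^ k * (\<i> * G ((m + int k) + 1) (n + 1))"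
      by (simp add: ac_simps)
    also have "\<dots> = \<i> ^ k * G (m + int k) (n + 1)" unfolding step1 by simp
    finally show ?case using Suc by simp
  qed simp
  have row2: "\<i> ^ k * G (m + int k) (n + 2) = G m (n + 2) + 2 * \<i> * of_nat k * G m (n + 1)" for k
  proof (induction k)
    case (Suc k)
    have "\<i> ^ Suc k * G (m + int (Suc k)) (n + 2) = \<i> ^ k * (\<i> * G ((m + int k) + 1) (n + 2))"
      by (simp add: ac_simps)
    also have "\<dots> = \<i> ^ k * G (m + int k) (n + 2) + 2 * \<i> * (\<i> ^ k * G (m + int k) (n + 1))"
      unfolding step2 by (simp add: algebra_simps)
    finally show ?case unfolding Suc row1 by (simp add: algebra_simps)
  qed simp
  have "real k * (2 * cmod (G m (n + 1))) \<le> 2 * B" for k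
  proof -
    have "2 * \<i> * of_nat k * G m (n + 1) = \<i> ^ k * G (m + int k) (n + 2) - G m (n + 2)"
      using row2[of k] by simp
    then have "cmod (2 * \<i> * of_nat k * G m (n + 1)) \<le> cmod (\<i> ^ k * G (m + int k) (n + 2)) + cmod (G m (n + 2))"
      by (simp only: norm_triangle_ineq4)
    also have "\<dots> \<le> 2 * B"
      using bounded[of "m + int k"] bounded[of m] by (simp add: norm_mult norm_power)
    finally show ?thesis by (simp add: norm_mult mult_ac)
  qed
  then have "\<not> 0 < 2 * cmod (G m (n + 1))"
    using ex_less_of_nat_mult[of "2 * cmod (G m (n + 1))" "2 * B"] by (auto simp: not_less[symmetric])
  then show ?thesis by simp
qed

lemma entire_eq_0_if_row_0_eq_0:
  assumes entire: "discrete_entire G"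
    and bounded: "\<And>n. \<exists>B. \<forall>m. cmod (G m n) \<le> B"
    and zero: "\<And>m. G m 0 = 0"
  shows "G m n = 0"
proof -
  have nonneg: "\<forall>m. H m (int k) = 0"
    if H: "discrete_entire H" "\<And>n. \<exists>B. \<forall>m. cmod (H m n) \<le> B" "\<And>m. H m 0 = 0" for H k
  proof (induction k)
    case (Suc k)
    obtain B where "\<And>m. cmod (H m (int k + 2)) \<le> B" using H(2) by blast
    then have "H m (int k + 1) = 0" for m
      using Suc by (intro entire_next_row_eq_0[OF H(1)]) auto
    then show ?case by (simp add: add.commute)
  qed (simp add: H)
  show ?thesis
  proof (cases "n \<ge> 0")
    case True
    then show ?thesis using nonneg[OF assms, of "nat n"] by simp
  next
    case False
    have "\<forall>m. (\<lambda>m n. G (- m) (- n)) m (int (nat (- n))) = 0"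
    proof (rule nonneg)
      show "discrete_entire (\<lambda>m n. G (- m) (- n))" by (rule discrete_entire_reflect[OF entire])
      show "\<exists>B. \<forall>m. cmod (G (- m) (- n)) \<le> B" for n using bounded[of "- n"] by blast
      show "G (- m) (- 0) = 0" for m using zero by simp
    qed
    from this[rule_format, of "- m"] show ?thesis using False by simp
  qed
qed

section \<open>The Paley-Wiener theorem\<close>

lemma PW_imp_PW_transform:
  assumes \<alpha>: "0 < \<alpha>" "\<alpha> < pi / 2" and F: "F \<in> PW \<alpha>"
  obtains f where "f \<in> L2_torus" "supp_subset f (D \<alpha>)" "F = PW_transform f"
proof -
  obtain c where entire: "discrete_entire F"
    and growth: "\<And>m n. cmod (F m n) \<le> c * growth_rate \<alpha> powi \<bar>n\<bar>"
    and l2: "(\<lambda>m. (cmod (F m 0))\<^sup>2) summable_on UNIV"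
    using F unfolding PW_def growth_rate_def by blast
  obtain f where f: "f \<in> L2_torus" "\<And>m. PW_transform f m 0 = F m 0"
    using Riesz_Fischer[OF l2] by blast
  have supp: "supp_subset f (D \<alpha>)"
    by (rule supp_subset_D[OF \<alpha> entire growth f])
  have fi: "integrable torus f" by (rule L2_torus_integrable[OF f(1)])
  define G where "G = (\<lambda>m n. F m n - PW_transform f m n)"
  have "discrete_entire G"
    using entire PW_transform_entire[OF \<alpha> fi supp] unfolding discrete_entire_def G_def
    by (simp add: algebra_simps)
  moreover have "\<exists>B. \<forall>m. cmod (G m n) \<le> B" for n
  proof (intro exI allI)
    fix m
    show "cmod (G m n) \<le> c * growth_rate \<alpha> powi \<bar>n\<bar> + (LINT t|torus. cmod (f t)) * growth_rate \<alpha> powi \<bar>n\<bar>"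
      unfolding G_def
      by (rule order_trans[OF norm_triangle_ineq4 add_mono[OF growth PW_transform_growth[OF \<alpha> fi supp]]])
  qed
  moreover have "G m 0 = 0" for m by (simp add: G_def f)
  ultimately have "G m n = 0" for m n by (rule entire_eq_0_if_row_0_eq_0)
  then have "F = PW_transform f" by (intro ext) (simp add: G_def)
  then show thesis using that f supp by blast
qed

theorem theorem1p5:
  fixes \<alpha> :: real
  assumes "0 < \<alpha>" and "\<alpha> < pi / 2"
  shows "(\<forall>F \<in> PW \<alpha>. \<exists>f \<in> L2_torus. supp_subset f (D \<alpha>) \<and>
            (\<forall>m n. F m n = PW_transform f m n) \<and>
            PW_norm F = (2 * pi) powr (- 1 / 2) * L2_torus_norm f) \<and>
         (\<forall>f \<in> L2_torus. supp_subset f (D \<alpha>) \<longrightarrow>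
            (\<forall>F. (\<forall>m n. F m n = PW_transform f m n) \<longrightarrow>
               F \<in> PW \<alpha> \<and>
               PW_norm F = (2 * pi) powr (- 1 / 2) * L2_torus_norm f))"
proof (intro conjI ballI allI impI)
  fix F assume "F \<in> PW \<alpha>"
  then obtain f where f: "f \<in> L2_torus" "supp_subset f (D \<alpha>)" "F = PW_transform f"
    using PW_imp_PW_transform[OF assms] by blast
  then show "\<exists>f \<in> L2_torus. supp_subset f (D \<alpha>) \<and> (\<forall>m n. F m n = PW_transform f m n) \<and>
      PW_norm F = (2 * pi) powr (- 1 / 2) * L2_torus_norm f"
    using PW_transform_in_PW(2)[OF assms f(1,2)] by blast
next
  fix f F assume f: "f \<in> L2_torus" "supp_subset f (D \<alpha>)" and "\<forall>m n. F m n = PW_transform f m n"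
  then have F: "F = PW_transform f" by blast
  show "F \<in> PW \<alpha>" "PW_norm F = (2 * pi) powr (- 1 / 2) * L2_torus_norm f"
    unfolding F by (rule PW_transform_in_PW[OF assms f])+
qed


end
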